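(* Let $\mathbb{T}=(T_1,T_2,T_3,\dots)$ be a sequence of starlike trees of bounded width, let $G_k(\mathbb T)=[T_1,\dots,T_k]$ for $k\ge1$, and let $\mu_0=\lim_{k\to\infty}\rho_L(G_k(\mathbb T))$. Let $\varepsilon>0$ and let $k_\varepsilon\ge1$ be such that $\rho_L(G_{k_\varepsilon}(\mathbb T))>\mu_0-\varepsilon$. (a) If $\hat{\mathbb T}=(T_1,\dots,T_{j_0-1},\hat T_{j_0},T_{j_0+1},\dots)$ is obtained from $\mathbb T$ by replacing the single entry $T_{j_0}$ by a starlike tree $\hat T_{j_0}$ with $\delta(\hat T_{j_0},\mu_0)>\delta(T_{j_0},\mu_0)$, then $\lim_{k\to\infty}\rho_L(G_k(\hat{\mathbb T}))\ge\mu_0$. (b) If $\tilde{\mathbb T}=(T_1,T_2,\dots,T_{k_\varepsilon},[0],[0],[0],\dots)$ and $\mu_1=\lim_{k\to\infty}\rho_L(G_k(\tilde{\mathbb T}))$, then $\mu_1\in(\mu_0-\varepsilon,\mu_0]$. (c) Let $\mathcal A$ be the set of all limits $\lim_{k\to\infty}\rho_L(G_k(\tilde{\mathbb T}))$ over all sequences of starlike trees of the form $\tilde{\mathbb T}=(T_1,\dots,T_{k_0},[0],[0],\dots)$, $k_0\ge1$. Then every element of $\mathcal A$ is an algebraic number. (d) Let $\mathcal B$ be the set of all limits $\lim_{k\to\infty}\rho_L(G_k(\mathbb T))$ over all sequences $\mathbb T$ of starlike trees of bounded width. Then $\mathcal A$ is dense in $\mathcal B$.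
   Context: For a finite graph $G$, $\rho_L(G)$ is the largest eigenvalue of the Laplacian matrix $L(G)=D(G)-A(G)$. A starlike tree is encoded as $T=[q_1,\dots,q_r]$ with positive integers $q_1\le\dots\le q_r$, or $T=[0]$ (empty); its width is $r$ (and $0$ for $[0]$). The linear tree $[T_1,\dots,T_k]$ is obtained from a path $v_1v_2\cdots v_k$ by attaching at each $v_j$, for $T_j=[q_1,\dots,q_r]$, $r$ disjoint pendant paths with $q_1,\dots,q_r$ vertices respectively (an end vertex of each is joined to $v_j$ by an edge); if $T_j=[0]$ nothing is attached. A sequence of starlike trees has bounded width if the widths of its members are bounded by a common constant. For such a sequence, $\rho_L([T_1,\dots,T_k])$ is strictly increasing in $k$ and bounded, so the limits in the statement exist. Drift: for real $\mu$ put $b_1=1-\mu$ and $b_{i+1}=2-\mu-\frac1{b_i}$. Then $\delta([q_1,\dots,q_r],\mu)=\sum_{i=1}^r\left(1-\frac1{b_{q_i}}\right)$ and $\delta([0],\mu)=0$. *)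

theory Defs
  imports
    "HOL-Analysis.Analysis"
    "HOL-Computational_Algebra.Polynomial"
    "Jordan_Normal_Form.Char_Poly"
begin

text \<open>A finite simple graph is given by its finite vertex set and its set of edges, each edge being
  a two-element set of vertices. To obtain matrices in the library's sense, the vertices are put in
  some order without repetition; the eigenvalues do not depend on that order.\<close>

definition vertex_list :: "'a set \<Rightarrow> 'a list" where
  "vertex_list V = (SOME vs. distinct vs \<and> set vs = V)"

definition adjacency_matrix :: "'a set \<times> 'a set set \<Rightarrow> real mat" where
  "adjacency_matrix = (\<lambda>(V, E). let vs = vertex_list V in
     mat (card V) (card V) (\<lambda>(a, b). if {vs ! a, vs ! b} \<in> E then 1 else 0))"

definition degree_matrix :: "'a set \<times> 'a set set \<Rightarrow> real mat" where
  "degree_matrix = (\<lambda>(V, E). let vs = vertex_list V in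
     mat (card V) (card V) (\<lambda>(a, b). if a = b then real (card {e \<in> E. vs ! a \<in> e}) else 0))"

definition laplacian_matrix :: "'a set \<times> 'a set set \<Rightarrow> real mat" where
  "laplacian_matrix G = degree_matrix G - adjacency_matrix G"

definition rho_L :: "'a set \<times> 'a set set \<Rightarrow> real" where
  "rho_L G = Max {x. eigenvalue (laplacian_matrix G) x}"

definition starlike_tree :: "nat list \<Rightarrow> bool" where
  "starlike_tree q \<longleftrightarrow> q = [0] \<or> (q \<noteq> [] \<and> sorted q \<and> (\<forall>x \<in> set q. 1 \<le> x))"

definition tree_width :: "nat list \<Rightarrow> nat" where
  "tree_width q = (if q = [0] then 0 else length q)"

text \<open>Positions in the lists are counted from 0. The path vertex at position \<open>j\<close> is \<open>(j, 0, 0)\<close>, and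
  \<open>(j, i, p)\<close> with \<open>p \<ge> 1\<close> is the \<open>p\<close>-th vertex, counted from the path, of the \<open>i\<close>-th pendant path at
  that position. An entry \<open>[0]\<close> contributes no vertex with \<open>p \<ge> 1\<close>.\<close>

definition linear_tree_verts :: "nat list list \<Rightarrow> (nat \<times> nat \<times> nat) set" where
  "linear_tree_verts Ts =
     {(j, 0, 0) | j. j < length Ts} \<union>
     {(j, i, p) | j i p. j < length Ts \<and> i < length (Ts ! j) \<and> 1 \<le> p \<and> p \<le> Ts ! j ! i}"

definition linear_tree_edges :: "nat list list \<Rightarrow> (nat \<times> nat \<times> nat) set set" where
  "linear_tree_edges Ts =
     {{(j, 0, 0), (Suc j, 0, 0)} | j. Suc j < length Ts} \<union>
     {{(j, 0, 0), (j, i, 1)} | j i. j < length Ts \<and> i < length (Ts ! j) \<and> 1 \<le> Ts ! j ! i} \<union>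
     {{(j, i, p), (j, i, Suc p)} | j i p.
        j < length Ts \<and> i < length (Ts ! j) \<and> 1 \<le> p \<and> Suc p \<le> Ts ! j ! i}"

definition linear_tree ::
    "nat list list \<Rightarrow> (nat \<times> nat \<times> nat) set \<times> (nat \<times> nat \<times> nat) set set" where
  "linear_tree Ts = (linear_tree_verts Ts, linear_tree_edges Ts)"

text \<open>A sequence \<open>T\<^sub>1, T\<^sub>2, \<dots>\<close> is a function on \<^typ>\<open>nat\<close> whose value at 0 is never used.\<close>

definition starlike_seq :: "(nat \<Rightarrow> nat list) \<Rightarrow> bool" where
  "starlike_seq T \<longleftrightarrow> (\<forall>j\<ge>1. starlike_tree (T j))"

definition bounded_width :: "(nat \<Rightarrow> nat list) \<Rightarrow> bool" where
  "bounded_width T \<longleftrightarrow> (\<exists>w. \<forall>j\<ge>1. tree_width (T j) \<le> w)"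

definition Gseq :: "(nat \<Rightarrow> nat list) \<Rightarrow> nat \<Rightarrow> (nat \<times> nat \<times> nat) set \<times> (nat \<times> nat \<times> nat) set set"
  where "Gseq T k = linear_tree (map T [1..<Suc k])"

definition rho_limit :: "(nat \<Rightarrow> nat list) \<Rightarrow> real" where
  "rho_limit T = lim (\<lambda>k. rho_L (Gseq T k))"

text \<open>The recursion starts at index 1; the value at index 0 is not used.\<close>

fun drift_b :: "real \<Rightarrow> nat \<Rightarrow> real" where
  "drift_b \<mu> 0 = 1"
| "drift_b \<mu> (Suc 0) = 1 - \<mu>"
| "drift_b \<mu> (Suc (Suc i)) = 2 - \<mu> - 1 / drift_b \<mu> (Suc i)"

definition drift :: "nat list \<Rightarrow> real \<Rightarrow> real" where
  "drift q \<mu> = (if q = [0] then 0 else (\<Sum>i<length q. 1 - 1 / drift_b \<mu> (q ! i)))"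

definition limits_A :: "real set" where
  "limits_A = {rho_limit T | T. starlike_seq T \<and> (\<exists>k0\<ge>1. \<forall>j>k0. T j = [0])}"

definition limits_B :: "real set" where
  "limits_B = {rho_limit T | T. starlike_seq T \<and> bounded_width T}"

end

theory Submission
  imports Defs "Jordan_Normal_Form.Spectral_Radius"
begin

text \<open>For \<open>\<mu> \<ge> 4\<close> the inequality \<open>\<rho>\<^sub>L \<le> \<mu>\<close> says that the form \<open>L - \<mu>\<close> is nonpositive. Maximising this form over the
  pendant paths leaves a form on the path \<open>v\<^sub>1 \<dots> v\<^sub>k\<close> with diagonal terms \<open>\<delta>(T\<^sub>j, \<mu>) - \<mu>\<close>, which is monotone in
  the drifts. If the limit dropped below \<open>\<mu>\<^sub>0\<close> after a replacement as in (a), then some \<open>\<mu> < \<mu>\<^sub>0\<close> above the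
  new limit at which, by continuity, the new drift is still the larger one would bound the old sequence. Parts (b)
  and (d) follow from the monotonicity of \<open>\<rho>\<^sub>L\<close> under enlarging the tree.

  For (c), an infinite trailing path contributes \<open>1 + 1 / t\<close> where \<open>\<mu> = 2 + t + 1 / t\<close> and \<open>t > 1\<close>. A limit above 4
  is then characterised by the vanishing of the last pivot of the reduced form, a rational function of \<open>t\<close>
  over the rationals that is negative for large \<open>t\<close>. Hence \<open>t\<close> is algebraic, and so is \<open>\<mu>\<close>.\<close>

section \<open>The Laplacian spectral radius as a Rayleigh quotient\<close>

text \<open>If \<open>b x y\<close> were nonzero, a small move from \<open>x\<close> along
  \<open>y\<close> with the right sign would make the form negative. This is what turns a maximiser
  of the Rayleigh quotient into an eigenvector.\<close>

lemma psd_form_zero_imp_ker: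
  fixes b :: "('a \<Rightarrow> real) \<Rightarrow> ('a \<Rightarrow> real) \<Rightarrow> real"
  assumes nonneg: "\<And>x. b x x \<ge> 0" and zero: "b x x = 0"
    and expand: "\<And>s. b (\<lambda>u. x u + s * y u) (\<lambda>u. x u + s * y u) = b x x + 2 * s * b x y + s\<^sup>2 * b y y"
  shows "b x y = 0"
proof (rule ccontr)
  assume nz: "b x y \<noteq> 0"
  \<comment> \<open>The minimiser of \<open>2 * s * b x y + s^2 * (b y y + 1)\<close>; the added 1
    keeps the denominator positive even if \<open>b y y = 0\<close>.\<close>
  define s where "s = - b x y / (b y y + 1)"
  have pos: "b y y + 1 > 0" using nonneg[of y] by simp
  have "2 * s * b x y + s\<^sup>2 * b y y \<ge> 0"
    using nonneg[of "\<lambda>u. x u + s * y u"] unfolding expand zero by simp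
  moreover have "2 * s * b x y + s\<^sup>2 * b y y \<le> 2 * s * b x y + s\<^sup>2 * (b y y + 1)"
    by (simp add: algebra_simps)
  moreover have "2 * s * b x y + s\<^sup>2 * (b y y + 1) = - (b x y)\<^sup>2 / (b y y + 1)"
    using pos unfolding s_def by (simp add: divide_simps) (simp add: algebra_simps power2_eq_square)
  moreover have "- (b x y)\<^sup>2 / (b y y + 1) < 0"
    using pos nz by (simp add: divide_neg_pos)
  ultimately show False by linarith
qed

text \<open>With values fixed to 0 outside \<open>V\<close>, the sphere is a closed subset of a
  product of compact sets, so Tychonoff's theorem applies.\<close>

lemma compact_unit_sphere_fun:
  fixes V :: "'a set"
  assumes "finite V"
  shows "compact {x :: 'a \<Rightarrow> real. (\<forall>u. u \<notin> V \<longrightarrow> x u = 0) \<and> (\<Sum>u\<in>V. (x u)\<^sup>2) = 1}"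
proof -
  let ?I = "\<lambda>u. if u \<in> V then {-1..1::real} else {0}"
  have eq: "{x. (\<forall>u. u \<notin> V \<longrightarrow> x u = 0) \<and> (\<Sum>u\<in>V. (x u)\<^sup>2) = 1}
        = PiE UNIV ?I \<inter> {x. (\<Sum>u\<in>V. (x u)\<^sup>2) = 1}"
  proof -
    have "x u \<in> {-1..1}" if "(\<Sum>u\<in>V. (x u)\<^sup>2) = 1" "u \<in> V" for x :: "'a \<Rightarrow> real" and u
    proof -
      have "(x u)\<^sup>2 \<le> (\<Sum>u\<in>V. (x u)\<^sup>2)"
        using assms that(2) by (intro member_le_sum) auto
      then have "\<bar>x u\<bar> \<le> 1" using that(1) abs_le_square_iff[of "x u" 1] by simp
      then show ?thesis by auto
    qed
    then show ?thesis by (auto simp: PiE_iff split: if_splits)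
  qed
  have "compactin (product_topology (\<lambda>_. euclidean) UNIV) (PiE UNIV ?I)"
    unfolding compactin_PiE by auto
  then have "compact (PiE UNIV ?I)"
    by (simp only: euclidean_product_topology compactin_euclidean_iff)
  moreover have "closed {x :: 'a \<Rightarrow> real. (\<Sum>u\<in>V. (x u)\<^sup>2) = 1}"
    by (intro closed_Collect_eq continuous_intros continuous_on_product_coordinates)
  ultimately show ?thesis unfolding eq by (rule compact_Int_closed)
qed

lemma vertex_list:
  assumes "finite V"
  shows "distinct (vertex_list V)" "set (vertex_list V) = V" "length (vertex_list V) = card V"
proof -
  have "\<exists>vs. distinct vs \<and> set vs = V" using finite_distinct_list[OF assms] by blast
  from someI_ex[OF this] show *: "distinct (vertex_list V)" "set (vertex_list V) = V"
    unfolding vertex_list_def by auto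
  then show "length (vertex_list V) = card V" using distinct_card by fastforce
qed

definition lap :: "'a set \<Rightarrow> 'a set set \<Rightarrow> ('a \<Rightarrow> real) \<Rightarrow> 'a \<Rightarrow> real" where
  "lap V E x u = (\<Sum>w\<in>V. if {u, w} \<in> E then x u - x w else 0)"

text \<open>The sum runs over ordered pairs, so every edge counts twice; hence the factors 2 further
  down.\<close>

definition dirichlet :: "'a set \<Rightarrow> 'a set set \<Rightarrow> ('a \<Rightarrow> real) \<Rightarrow> ('a \<Rightarrow> real) \<Rightarrow> real" where
  "dirichlet V E x y = (\<Sum>u\<in>V. \<Sum>w\<in>V. if {u, w} \<in> E then (x u - x w) * (y u - y w) else 0)"

text \<open>Summation by parts: exchanging the two ends of each edge turns the \<open>y w\<close>
  half into the \<open>y u\<close> half.\<close>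

lemma dirichlet_lap: "dirichlet V E x y = 2 * (\<Sum>u\<in>V. lap V E x u * y u)"
proof -
  have "dirichlet V E x y = (\<Sum>u\<in>V. \<Sum>w\<in>V. (if {u, w} \<in> E then x u - x w else 0) * y u)
      + (\<Sum>u\<in>V. \<Sum>w\<in>V. (if {w, u} \<in> E then x w - x u else 0) * y w)"
    unfolding dirichlet_def sum.distrib[symmetric]
    by (intro sum.cong refl) (auto simp: insert_commute algebra_simps)
  also have "(\<Sum>u\<in>V. \<Sum>w\<in>V. (if {w, u} \<in> E then x w - x u else 0) * y w)
      = (\<Sum>u\<in>V. \<Sum>w\<in>V. (if {u, w} \<in> E then x u - x w else 0) * y u)"
    by (rule sum.swap)
  finally show ?thesis by (simp add: lap_def sum_distrib_right)
qed

text \<open>The order of the vertices enters only as a bijection between indices and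
  \<open>V\<close>, which carries vectors to functions on \<open>V\<close>.\<close>

lemma eigenvalue_laplacian_iff:
  assumes V: "finite V" and E: "\<And>e. e \<in> E \<Longrightarrow> \<exists>u\<in>V. \<exists>w\<in>V. u \<noteq> w \<and> e = {u, w}"
  shows "eigenvalue (laplacian_matrix (V, E)) l \<longleftrightarrow>
    (\<exists>x. (\<exists>u\<in>V. x u \<noteq> 0) \<and> (\<forall>u\<in>V. lap V E x u = l * x u))"
proof -
  define n where "n = card V"
  define vs where "vs = vertex_list V"
  define L where "L = laplacian_matrix (V, E)"
  have vs: "distinct vs" "set vs = V" "length vs = n"
    using vertex_list[OF V] by (auto simp: vs_def n_def)
  have bij: "bij_betw (\<lambda>a. vs ! a) {..<n} V"
    using vs bij_betw_nth by (metis lessThan_atLeast0)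
  have nth: "\<exists>a<n. u = vs ! a" if "u \<in> V" for u
  proof -
    have "u \<in> (\<lambda>a. vs ! a) ` {..<n}" using that bij by (simp add: bij_betw_def)
    then show ?thesis by auto
  qed
  have L: "L \<in> carrier_mat n n"
    by (auto simp: L_def laplacian_matrix_def degree_matrix_def adjacency_matrix_def Let_def n_def)
  have Lab: "L $$ (a, b) = (if a = b then real (card {e \<in> E. vs ! a \<in> e}) else 0)
      - (if {vs ! a, vs ! b} \<in> E then 1 else 0)" if "a < n" "b < n" for a b
    using that by (simp add: L_def laplacian_matrix_def degree_matrix_def adjacency_matrix_def
        Let_def n_def vs_def)
  \<comment> \<open>Edges are pairs of distinct vertices, so those at \<open>u\<close> correspond to
    the neighbours \<open>w\<close> of \<open>u\<close> through \<open>{u, w}\<close>.\<close>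
  have deg: "real (card {e \<in> E. u \<in> e}) = (\<Sum>w\<in>V. if {u, w} \<in> E then 1 else 0)" if "u \<in> V" for u
  proof -
    have "bij_betw (\<lambda>w. {u, w}) {w \<in> V. {u, w} \<in> E} {e \<in> E. u \<in> e}"
      unfolding bij_betw_def
    proof
      show "inj_on (\<lambda>w. {u, w}) {w \<in> V. {u, w} \<in> E}"
        by (rule inj_onI) (auto simp: doubleton_eq_iff)
      show "(\<lambda>w. {u, w}) ` {w \<in> V. {u, w} \<in> E} = {e \<in> E. u \<in> e}"
      proof (intro equalityI subsetI)
        fix e assume "e \<in> {e \<in> E. u \<in> e}"
        moreover from this obtain v w where "v \<in> V" "w \<in> V" "e = {v, w}" using E by blast
        ultimately show "e \<in> (\<lambda>w. {u, w}) ` {w \<in> V. {u, w} \<in> E}"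
          by (auto simp: insert_commute)
      qed auto
    qed
    from bij_betw_same_card[OF this] show ?thesis using V by (simp flip: sum.inter_filter)
  qed
  have act: "(L *\<^sub>v v) $ a = lap V E x (vs ! a)"
    if v: "v \<in> carrier_vec n" and a: "a < n" and x: "\<And>b. b < n \<Longrightarrow> x (vs ! b) = v $ b" for v a x
  proof -
    have aV: "vs ! a \<in> V" using a vs by force
    have "(L *\<^sub>v v) $ a = (\<Sum>b<n. L $$ (a, b) * v $ b)"
      using L v a by (simp add: scalar_prod_def lessThan_atLeast0)
    also have "\<dots> = (\<Sum>b<n. (if a = b then real (card {e \<in> E. vs ! a \<in> e}) * v $ b else 0)
        - (if {vs ! a, vs ! b} \<in> E then v $ b else 0))"
      using a by (intro sum.cong refl) (auto simp: Lab algebra_simps)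
    also have "\<dots> = real (card {e \<in> E. vs ! a \<in> e}) * v $ a
        - (\<Sum>b<n. if {vs ! a, vs ! b} \<in> E then v $ b else 0)"
      using a by (simp add: sum_subtractf)
    also have "(\<Sum>b<n. if {vs ! a, vs ! b} \<in> E then v $ b else 0)
        = (\<Sum>b<n. if {vs ! a, vs ! b} \<in> E then x (vs ! b) else 0)"
      by (intro sum.cong refl) (auto simp: x)
    also have "\<dots> = (\<Sum>w\<in>V. if {vs ! a, w} \<in> E then x w else 0)"
      by (rule sum.reindex_bij_betw[OF bij])
    also have "v $ a = x (vs ! a)" using x a by simp
    finally show ?thesis
      unfolding lap_def deg[OF aV] sum_distrib_right sum_subtractf[symmetric]
      by (auto intro!: sum.cong)
  qed
  show ?thesis
  proof
    assume "eigenvalue (laplacian_matrix (V, E)) l"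
    then obtain v where v: "v \<in> carrier_vec n" "v \<noteq> 0\<^sub>v n" "L *\<^sub>v v = l \<cdot>\<^sub>v v"
      using L unfolding eigenvalue_def eigenvector_def L_def[symmetric] by auto
    define x where "x u = v $ (inv_into {..<n} (\<lambda>a. vs ! a) u)" for u
    have x: "x (vs ! b) = v $ b" if "b < n" for b
      using that bij unfolding x_def bij_betw_def by (subst inv_into_f_f) auto
    obtain b where b: "b < n" "v $ b \<noteq> 0" using v(1,2) by fastforce
    have "x (vs ! b) \<noteq> 0" "vs ! b \<in> V" using b x vs by auto
    moreover have "lap V E x u = l * x u" if "u \<in> V" for u
    proof -
      obtain a where a: "a < n" "u = vs ! a" using nth \<open>u \<in> V\<close> by blast
      show ?thesis using act[OF v(1) a(1) x] v(1,3) a x by simp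
    qed
    ultimately show "\<exists>x. (\<exists>u\<in>V. x u \<noteq> 0) \<and> (\<forall>u\<in>V. lap V E x u = l * x u)" by blast
  next
    assume "\<exists>x. (\<exists>u\<in>V. x u \<noteq> 0) \<and> (\<forall>u\<in>V. lap V E x u = l * x u)"
    then obtain x u where x: "u \<in> V" "x u \<noteq> 0" "\<And>u. u \<in> V \<Longrightarrow> lap V E x u = l * x u" by blast
    define v where "v = vec n (\<lambda>a. x (vs ! a))"
    obtain a where a: "a < n" "u = vs ! a" using nth[OF x(1)] by blast
    have va: "v $ a \<noteq> 0" using a x(2) by (simp add: v_def)
    have v: "v \<in> carrier_vec n" by (simp add: v_def)
    have v0: "v \<noteq> 0\<^sub>v n"
    proof
      assume "v = 0\<^sub>v n"
      then show False using va a(1) by simp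
    qed
    have "L *\<^sub>v v = l \<cdot>\<^sub>v v"
    proof (rule eq_vecI)
      fix i assume "i < dim_vec (l \<cdot>\<^sub>v v)"
      then have i: "i < n" by (simp add: v_def)
      have "vs ! i \<in> V" using i vs by auto
      then show "(L *\<^sub>v v) $ i = (l \<cdot>\<^sub>v v) $ i"
        using act[OF v i, of x] i x(3) by (simp add: v_def)
    qed (use L in \<open>auto simp: v_def\<close>)
    then show "eigenvalue (laplacian_matrix (V, E)) l"
      using v v0 L unfolding eigenvalue_def eigenvector_def L_def[symmetric] by auto
  qed
qed

text \<open>By compactness the Rayleigh quotient has a maximiser. It is an eigenvector, and each
  eigenvalue is the quotient at its own eigenvector, so the maximum is \<open>rho_L\<close>.\<close>

lemma rho_L_le_iff:
  assumes V: "finite V" "V \<noteq> {}"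
    and E: "\<And>e. e \<in> E \<Longrightarrow> \<exists>u\<in>V. \<exists>w\<in>V. u \<noteq> w \<and> e = {u, w}"
  shows "rho_L (V, E) \<le> \<mu> \<longleftrightarrow> (\<forall>x. dirichlet V E x x \<le> 2 * \<mu> * (\<Sum>u\<in>V. (x u)\<^sup>2))"
proof -
  let ?ev = "{l. eigenvalue (laplacian_matrix (V, E)) l}"
  note eig = eigenvalue_laplacian_iff[OF V(1) E]
  let ?S = "{x :: 'a \<Rightarrow> real. (\<forall>u. u \<notin> V \<longrightarrow> x u = 0) \<and> (\<Sum>u\<in>V. (x u)\<^sup>2) = 1}"
  obtain v where v: "v \<in> V" using V by auto
  have "?S \<noteq> {}"
  proof -
    define x where "x u = (if u = v then 1 else 0 :: real)" for u
    have "(\<Sum>u\<in>V. (x u)\<^sup>2) = (\<Sum>u\<in>V. if u = v then 1 else 0)"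
      by (intro sum.cong) (auto simp: x_def)
    also have "\<dots> = 1" using v V(1) by simp
    finally have "x \<in> ?S" using v by (auto simp: x_def)
    then show ?thesis by blast
  qed
  moreover have "continuous_on ?S (\<lambda>x. dirichlet V E x x)"
    unfolding dirichlet_def
  proof (intro continuous_on_sum)
    fix u w
    have "continuous_on ?S (\<lambda>x. (x u - x w) * (x u - x w))"
      by (intro continuous_intros continuous_on_subset[OF continuous_on_product_coordinates]) auto
    then show "continuous_on ?S (\<lambda>x. if {u, w} \<in> E then (x u - x w) * (x u - x w) else 0)"
      by (cases "{u, w} \<in> E") auto
  qed
  ultimately have "\<exists>x\<in>?S. \<forall>y\<in>?S. dirichlet V E y y \<le> dirichlet V E x x"
    by (rule continuous_attains_sup[OF compact_unit_sphere_fun[OF V(1)]])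
  then obtain x where x_in: "x \<in> ?S" and x_max: "\<forall>y\<in>?S. dirichlet V E y y \<le> dirichlet V E x x"
    by (rule bexE)
  note x = x_in bspec[OF x_max]
  define m where "m = dirichlet V E x x / 2"
  have max: "dirichlet V E y y \<le> 2 * m * (\<Sum>u\<in>V. (y u)\<^sup>2)" for y
  proof (cases "(\<Sum>u\<in>V. (y u)\<^sup>2) = 0")
    case True
    then have "\<forall>u\<in>V. y u = 0" using V(1) by (simp add: sum_nonneg_eq_0_iff)
    then have "dirichlet V E y y = 0" unfolding dirichlet_def by (intro sum.neutral ballI) auto
    then show ?thesis using True by simp
  next
    case False
    define N where "N = (\<Sum>u\<in>V. (y u)\<^sup>2)"
    have N: "N > 0" using False unfolding N_def by (metis less_eq_real_def sum_nonneg zero_le_power2)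
    define z where "z u = (if u \<in> V then y u / sqrt N else 0)" for u
    have "(\<Sum>u\<in>V. (z u)\<^sup>2) = (\<Sum>u\<in>V. (y u)\<^sup>2 / N)"
      using N by (intro sum.cong) (auto simp: z_def power_divide)
    also have "\<dots> = 1" using N by (simp add: sum_divide_distrib[symmetric] N_def)
    finally have "z \<in> ?S" by (auto simp: z_def)
    then have "dirichlet V E z z \<le> 2 * m" using x(2) by (simp add: m_def)
    moreover have "dirichlet V E z z = dirichlet V E y y / N"
      unfolding dirichlet_def sum_divide_distrib
      using N by (intro sum.cong refl) (auto simp: z_def diff_divide_distrib[symmetric])
    ultimately show ?thesis using N by (simp add: field_simps N_def)
  qed
  \<comment> \<open>Nonnegative because \<open>m\<close> is the maximum, and zero at
    \<open>x\<close>; hence \<open>x\<close> lies in the kernel, which is the eigenvalue equation in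
    weak form.\<close>
  define b where "b y z = 2 * m * (\<Sum>u\<in>V. y u * z u) - dirichlet V E y z" for y z
  have bx: "b x y = 0" for y
  proof (rule psd_form_zero_imp_ker[of b])
    show "b y y \<ge> 0" for y using max[of y] by (simp add: b_def power2_eq_square)
    show "b x x = 0" using x(1) by (simp add: b_def m_def power2_eq_square)
    fix s
    have "dirichlet V E (\<lambda>u. x u + s * y u) (\<lambda>u. x u + s * y u) =
        dirichlet V E x x + 2 * s * dirichlet V E x y + s\<^sup>2 * dirichlet V E y y"
      unfolding dirichlet_def sum_distrib_left sum.distrib[symmetric]
      by (intro sum.cong refl) (auto simp: power2_eq_square algebra_simps)
    moreover have "(\<Sum>u\<in>V. (x u + s * y u) * (x u + s * y u)) =
        (\<Sum>u\<in>V. x u * x u) + 2 * s * (\<Sum>u\<in>V. x u * y u) + s\<^sup>2 * (\<Sum>u\<in>V. y u * y u)"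
      unfolding sum_distrib_left sum.distrib[symmetric]
      by (intro sum.cong refl) (auto simp: power2_eq_square algebra_simps)
    ultimately show "b (\<lambda>u. x u + s * y u) (\<lambda>u. x u + s * y u) = b x x + 2 * s * b x y + s\<^sup>2 * b y y"
      unfolding b_def by (simp add: algebra_simps)
  qed
  \<comment> \<open>Testing the weak equation against the indicator of \<open>u\<close> isolates the
    coordinate at \<open>u\<close>.\<close>
  have "lap V E x u = m * x u" if u: "u \<in> V" for u
    using bx[of "\<lambda>w. if w = u then 1 else 0"] u V(1)
    by (simp add: b_def dirichlet_lap if_distrib cong: if_cong)
  moreover have "\<exists>u\<in>V. x u \<noteq> 0"
  proof (rule ccontr)
    assume "\<not> ?thesis"
    then have "(\<Sum>u\<in>V. (x u)\<^sup>2) = 0" by (intro sum.neutral) auto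
    then show False using x(1) by simp
  qed
  ultimately have m_ev: "m \<in> ?ev" by (auto simp: eig)
  have le_m: "l \<le> m" if "l \<in> ?ev" for l
  proof -
    have "\<exists>y. (\<exists>u\<in>V. y u \<noteq> 0) \<and> (\<forall>u\<in>V. lap V E y u = l * y u)"
      using that by (simp add: eig)
    then obtain y u where y: "u \<in> V" "y u \<noteq> 0" "\<And>u. u \<in> V \<Longrightarrow> lap V E y u = l * y u"
      by blast
    have "dirichlet V E y y = 2 * l * (\<Sum>u\<in>V. (y u)\<^sup>2)"
      unfolding dirichlet_lap by (simp add: y(3) sum_distrib_left power2_eq_square mult.assoc)
    with max[of y] have "l * (\<Sum>u\<in>V. (y u)\<^sup>2) \<le> m * (\<Sum>u\<in>V. (y u)\<^sup>2)" by simp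
    moreover have "(\<Sum>u\<in>V. (y u)\<^sup>2) > 0"
      using y V(1) by (intro sum_pos2[of _ u]) auto
    ultimately show ?thesis by simp
  qed
  have fin: "finite ?ev"
  proof -
    have "laplacian_matrix (V, E) \<in> carrier_mat (card V) (card V)"
      by (auto simp: laplacian_matrix_def degree_matrix_def adjacency_matrix_def Let_def)
    from card_finite_spectrum(1)[OF this] show ?thesis by (simp add: spectrum_def)
  qed
  have rho: "rho_L (V, E) = m"
    unfolding rho_L_def using m_ev le_m by (intro Max_eqI fin) auto
  show ?thesis
  proof
    assume "rho_L (V, E) \<le> \<mu>"
    then have m\<mu>: "m \<le> \<mu>" using rho by simp
    show "\<forall>x. dirichlet V E x x \<le> 2 * \<mu> * (\<Sum>u\<in>V. (x u)\<^sup>2)"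
    proof
      fix y :: "'a \<Rightarrow> real"
      have "m * (\<Sum>u\<in>V. (y u)\<^sup>2) \<le> \<mu> * (\<Sum>u\<in>V. (y u)\<^sup>2)"
        by (intro mult_right_mono m\<mu> sum_nonneg) auto
      then show "dirichlet V E y y \<le> 2 * \<mu> * (\<Sum>u\<in>V. (y u)\<^sup>2)" using max[of y] by simp
    qed
  next
    assume "\<forall>x. dirichlet V E x x \<le> 2 * \<mu> * (\<Sum>u\<in>V. (x u)\<^sup>2)"
    then have "dirichlet V E x x \<le> 2 * \<mu> * (\<Sum>u\<in>V. (x u)\<^sup>2)" by blast
    then show "rho_L (V, E) \<le> \<mu>" using x(1) rho by (simp add: m_def)
  qed
qed

section \<open>The quadratic form of a linear tree\<close>

text \<open>The edges of a linear tree are exactly the pairs of a vertex other than \<open>(0, 0, 0)\<close> with its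
  parent, so that sums over edges become sums over vertices.\<close>

fun parent :: "nat \<times> nat \<times> nat \<Rightarrow> nat \<times> nat \<times> nat" where
  "parent (j, i, Suc (Suc p)) = (j, i, Suc p)"
| "parent (j, i, Suc 0) = (j, 0, 0)"
| "parent (j, i, 0) = (j - 1, 0, 0)"

definition tree_form :: "(nat \<times> nat \<times> nat) set \<Rightarrow> (nat \<times> nat \<times> nat \<Rightarrow> real) \<Rightarrow> real" where
  "tree_form V x = (\<Sum>v\<in>V - {(0, 0, 0)}. (x v - x (parent v))\<^sup>2)"

lemma linear_tree_verts_alt:
  "linear_tree_verts Ts = (\<lambda>j. (j, 0, 0)) ` {..<length Ts} \<union>
     (\<lambda>(j, i, p). (j, i, p)) `
       (SIGMA j:{..<length Ts}. SIGMA i:{..<length (Ts ! j)}. {1..Ts ! j ! i})"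
  unfolding linear_tree_verts_def by (auto simp: image_iff)

lemma finite_linear_tree_verts: "finite (linear_tree_verts Ts)"
  unfolding linear_tree_verts_alt by (intro finite_UnI finite_imageI finite_SigmaI) auto

lemma root_in_linear_tree_verts: "Ts \<noteq> [] \<Longrightarrow> (0, 0, 0) \<in> linear_tree_verts Ts"
  unfolding linear_tree_verts_def by simp

definition depth :: "nat \<times> nat \<times> nat \<Rightarrow> nat" where
  "depth = (\<lambda>(j, i, p). j + p)"

text \<open>The root is its own parent because \<open>0 - 1 = 0\<close> on
  \<open>nat\<close>.\<close>

lemma parent_in_linear_tree_verts:
  assumes "v \<in> linear_tree_verts Ts"
  shows "parent v \<in> linear_tree_verts Ts"
  using assms by (cases v rule: parent.cases) (auto simp: linear_tree_verts_def)

lemma depth_parent: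
  assumes "v \<in> linear_tree_verts Ts" "v \<noteq> (0, 0, 0)"
  shows "depth (parent v) < depth v"
  using assms by (cases v rule: parent.cases) (auto simp: linear_tree_verts_def depth_def)

lemma linear_tree_edges_alt:
  "linear_tree_edges Ts = (\<lambda>v. {v, parent v}) ` (linear_tree_verts Ts - {(0, 0, 0)})"
proof (intro equalityI subsetI)
  fix e assume "e \<in> linear_tree_edges Ts"
  then consider j where "e = {(j, 0, 0), (Suc j, 0, 0)}" "Suc j < length Ts"
    | j i where "e = {(j, 0, 0), (j, i, 1)}" "j < length Ts" "i < length (Ts ! j)" "1 \<le> Ts ! j ! i"
    | j i p where "e = {(j, i, p), (j, i, Suc p)}" "j < length Ts" "i < length (Ts ! j)"
        "1 \<le> p" "Suc p \<le> Ts ! j ! i"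
    unfolding linear_tree_edges_def by blast
  then show "e \<in> (\<lambda>v. {v, parent v}) ` (linear_tree_verts Ts - {(0, 0, 0)})"
  proof cases
    case 1
    then show ?thesis
      by (intro image_eqI[of _ _ "(Suc j, 0, 0)"]) (auto simp: linear_tree_verts_def insert_commute)
  next
    case 2
    then show ?thesis
      by (intro image_eqI[of _ _ "(j, i, 1)"]) (auto simp: linear_tree_verts_def insert_commute)
  next
    case 3
    then obtain p' where "p = Suc p'" by (cases p) auto
    with 3 show ?thesis
      by (intro image_eqI[of _ _ "(j, i, Suc p)"]) (auto simp: linear_tree_verts_def insert_commute)
  qed
next
  fix e assume "e \<in> (\<lambda>v. {v, parent v}) ` (linear_tree_verts Ts - {(0, 0, 0)})"
  then obtain v where v: "v \<in> linear_tree_verts Ts" "v \<noteq> (0, 0, 0)" "e = {v, parent v}" by auto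
  show "e \<in> linear_tree_edges Ts"
  proof (cases v rule: parent.cases)
    case (1 j i p)
    then show ?thesis using v by (fastforce simp: linear_tree_verts_def linear_tree_edges_def insert_commute)
  next
    case (2 j i)
    then show ?thesis using v by (fastforce simp: linear_tree_verts_def linear_tree_edges_def insert_commute)
  next
    case (3 j i)
    with v obtain j' where "j = Suc j'" by (cases j) (auto simp: linear_tree_verts_def)
    with 3 show ?thesis using v by (fastforce simp: linear_tree_verts_def linear_tree_edges_def insert_commute)
  qed
qed

text \<open>Each edge occurs once directed to the parent and once from it; \<open>depth\<close>
  tells the two directions apart.\<close>

lemma dirichlet_linear_tree:
  "dirichlet (linear_tree_verts Ts) (linear_tree_edges Ts) x x = 2 * tree_form (linear_tree_verts Ts) x"
proof -
  let ?V = "linear_tree_verts Ts" and ?E = "linear_tree_edges Ts"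
  let ?V' = "?V - {(0, 0, 0)}"
  let ?f = "\<lambda>v. (v, parent v)" and ?g = "\<lambda>v. (parent v, v)"
  let ?q = "\<lambda>(u, w). (x u - x w) * (x u - x w)"
  have fin: "finite ?V" by (rule finite_linear_tree_verts)
  have dp: "depth (parent v) < depth v" if "v \<in> ?V'" for v using that depth_parent by blast
  have ori: "{(u, w) \<in> ?V \<times> ?V. {u, w} \<in> ?E} = ?f ` ?V' \<union> ?g ` ?V'"
    using parent_in_linear_tree_verts
    by (auto simp: linear_tree_edges_alt doubleton_eq_iff image_iff)
  have "?f v \<noteq> ?g w" if "v \<in> ?V'" "w \<in> ?V'" for v w
    using dp[OF that(1)] dp[OF that(2)] by auto
  then have disj: "?f ` ?V' \<inter> ?g ` ?V' = {}" by blast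
  have "dirichlet ?V ?E x x = (\<Sum>e\<in>?V \<times> ?V. if (case e of (u, w) \<Rightarrow> {u, w} \<in> ?E) then ?q e else 0)"
    unfolding dirichlet_def sum.cartesian_product by (intro sum.cong refl) auto
  also have "\<dots> = sum ?q {e \<in> ?V \<times> ?V. case e of (u, w) \<Rightarrow> {u, w} \<in> ?E}"
    using fin by (intro sum.inter_filter[symmetric]) auto
  also have "{e \<in> ?V \<times> ?V. case e of (u, w) \<Rightarrow> {u, w} \<in> ?E} = ?f ` ?V' \<union> ?g ` ?V'"
    using ori by auto
  also have "sum ?q \<dots> = sum ?q (?f ` ?V') + sum ?q (?g ` ?V')"
    using fin disj by (intro sum.union_disjoint) auto
  also have "sum ?q (?f ` ?V') = tree_form ?V x"
    unfolding tree_form_def by (subst sum.reindex) (auto simp: inj_on_def power2_eq_square)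
  also have "sum ?q (?g ` ?V') = tree_form ?V x"
    unfolding tree_form_def
    by (subst sum.reindex) (auto simp: inj_on_def power2_eq_square algebra_simps)
  finally show ?thesis by simp
qed

lemma rho_L_linear_tree_le_iff:
  assumes "Ts \<noteq> []"
  shows "rho_L (linear_tree Ts) \<le> \<mu> \<longleftrightarrow>
    (\<forall>x. tree_form (linear_tree_verts Ts) x \<le> \<mu> * (\<Sum>v\<in>linear_tree_verts Ts. (x v)\<^sup>2))"
proof -
  have "\<exists>u\<in>linear_tree_verts Ts. \<exists>w\<in>linear_tree_verts Ts. u \<noteq> w \<and> e = {u, w}"
    if e: "e \<in> linear_tree_edges Ts" for e
  proof -
    obtain v where v: "v \<in> linear_tree_verts Ts" "v \<noteq> (0, 0, 0)" "e = {v, parent v}"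
      using e unfolding linear_tree_edges_alt by auto
    moreover have "v \<noteq> parent v" using depth_parent[OF v(1,2)] by auto
    ultimately show ?thesis using parent_in_linear_tree_verts by blast
  qed
  moreover have "linear_tree_verts Ts \<noteq> {}" using root_in_linear_tree_verts[OF assms] by blast
  ultimately have "rho_L (linear_tree_verts Ts, linear_tree_edges Ts) \<le> \<mu> \<longleftrightarrow>
      (\<forall>x. dirichlet (linear_tree_verts Ts) (linear_tree_edges Ts) x x
        \<le> 2 * \<mu> * (\<Sum>v\<in>linear_tree_verts Ts. (x v)\<^sup>2))"
    by (intro rho_L_le_iff finite_linear_tree_verts)
  then show ?thesis by (simp add: linear_tree_def dirichlet_linear_tree)
qed

text \<open>A function on the smaller tree is extended by zero. Closure under \<open>parent\<close>
  keeps the edges of the smaller tree intact, and further edges only add nonnegative terms.\<close>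

lemma rho_L_linear_tree_mono:
  assumes "Ts \<noteq> []" and sub: "linear_tree_verts Ts \<subseteq> linear_tree_verts Us"
  shows "rho_L (linear_tree Ts) \<le> rho_L (linear_tree Us)"
proof -
  let ?V = "linear_tree_verts Ts" and ?W = "linear_tree_verts Us"
  have "Us \<noteq> []" using root_in_linear_tree_verts[OF assms(1)] sub by (auto simp: linear_tree_verts_def)
  note U = rho_L_linear_tree_le_iff[OF this, of "rho_L (linear_tree Us)", simplified]
  have "tree_form ?V x \<le> rho_L (linear_tree Us) * (\<Sum>v\<in>?V. (x v)\<^sup>2)" for x
  proof -
    define y where "y v = (if v \<in> ?V then x v else 0)" for v
    have "tree_form ?V x = (\<Sum>v\<in>?V - {(0, 0, 0)}. (y v - y (parent v))\<^sup>2)"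
      unfolding tree_form_def y_def using parent_in_linear_tree_verts by (intro sum.cong) auto
    also have "\<dots> \<le> tree_form ?W y"
      unfolding tree_form_def using sub finite_linear_tree_verts by (intro sum_mono2) auto
    also have "\<dots> \<le> rho_L (linear_tree Us) * (\<Sum>v\<in>?W. (y v)\<^sup>2)" using U by blast
    also have "(\<Sum>v\<in>?W. (y v)\<^sup>2) = (\<Sum>v\<in>?V. (x v)\<^sup>2)"
      using sub finite_linear_tree_verts by (intro sum.mono_neutral_cong_right) (auto simp: y_def)
    finally show ?thesis .
  qed
  then show ?thesis using rho_L_linear_tree_le_iff[OF assms(1)] by blast
qed

text \<open>From \<open>(a - b)^2 \<le> 2 * a^2 + 2 * b^2\<close> and at most \<open>w + 2\<close>
  children per vertex one gets the constant \<open>2 + 2 * (w + 2)\<close>.\<close>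

lemma rho_L_linear_tree_bounded:
  assumes w: "\<And>q. q \<in> set Ts \<Longrightarrow> length q \<le> w"
  shows "Ts \<noteq> [] \<Longrightarrow> rho_L (linear_tree Ts) \<le> 2 * real w + 6"
proof -
  assume ne: "Ts \<noteq> []"
  let ?V = "linear_tree_verts Ts"
  have fin: "finite ?V" by (rule finite_linear_tree_verts)
  have ch: "card {v \<in> ?V - {(0, 0, 0)}. parent v = u} \<le> w + 2" for u
  proof -
    obtain j i p where u: "u = (j, i, p)" by (cases u) auto
    let ?C = "{(Suc j, 0, 0), (j, i, Suc p)} \<union> (\<lambda>i'. (j, i', 1)) ` {..<w}"
    have "v \<in> ?C" if "v \<in> ?V" "v \<noteq> (0, 0, 0)" "parent v = u" for v
      using that w nth_mem unfolding u
      by (cases v rule: parent.cases) (fastforce simp: linear_tree_verts_def)+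
    then have "{v \<in> ?V - {(0, 0, 0)}. parent v = u} \<subseteq> ?C" by blast
    then have "card {v \<in> ?V - {(0, 0, 0)}. parent v = u} \<le> card ?C" by (intro card_mono) auto
    also have "\<dots> \<le> card {(Suc j, 0, 0), (j, i, Suc p)} + card ((\<lambda>i'. (j, i', 1::nat)) ` {..<w})"
      by (rule card_Un_le)
    also have "\<dots> \<le> 2 + w"
      using card_image_le[of "{..<w}" "\<lambda>i'. (j, i', 1::nat)"] by (intro add_mono) auto
    finally show ?thesis by simp
  qed
  have "tree_form ?V x \<le> (2 * real w + 6) * (\<Sum>v\<in>?V. (x v)\<^sup>2)" for x
  proof -
    let ?V' = "?V - {(0, 0, 0)}"
    have sq: "(a - b)\<^sup>2 \<le> 2 * a\<^sup>2 + 2 * b\<^sup>2" for a b :: real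
      using zero_le_power2[of "a + b"] by (simp add: power2_eq_square algebra_simps)
    have "(\<Sum>v\<in>?V'. (x (parent v))\<^sup>2) = (\<Sum>u\<in>?V. \<Sum>v\<in>{v \<in> ?V'. parent v = u}. (x (parent v))\<^sup>2)"
      using fin parent_in_linear_tree_verts by (intro sum.group[symmetric]) auto
    also have "\<dots> = (\<Sum>u\<in>?V. card {v \<in> ?V'. parent v = u} * (x u)\<^sup>2)"
      by (intro sum.cong refl) simp
    also have "\<dots> \<le> (\<Sum>u\<in>?V. real (w + 2) * (x u)\<^sup>2)"
      using ch by (intro sum_mono mult_right_mono of_nat_mono) auto
    finally have par: "(\<Sum>v\<in>?V'. (x (parent v))\<^sup>2) \<le> real (w + 2) * (\<Sum>u\<in>?V. (x u)\<^sup>2)"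
      by (simp add: sum_distrib_left)
    have "tree_form ?V x \<le> (\<Sum>v\<in>?V'. 2 * (x v)\<^sup>2 + 2 * (x (parent v))\<^sup>2)"
      unfolding tree_form_def by (intro sum_mono sq)
    also have "\<dots> = 2 * (\<Sum>v\<in>?V'. (x v)\<^sup>2) + 2 * (\<Sum>v\<in>?V'. (x (parent v))\<^sup>2)"
      by (simp add: sum.distrib sum_distrib_left)
    also have "(\<Sum>v\<in>?V'. (x v)\<^sup>2) \<le> (\<Sum>v\<in>?V. (x v)\<^sup>2)"
      using fin by (intro sum_mono2) auto
    finally have "tree_form ?V x \<le> 2 * (\<Sum>v\<in>?V. (x v)\<^sup>2) + 2 * (\<Sum>v\<in>?V'. (x (parent v))\<^sup>2)"
      by simp
    also have "\<dots> \<le> 2 * (\<Sum>v\<in>?V. (x v)\<^sup>2) + 2 * (real (w + 2) * (\<Sum>u\<in>?V. (x u)\<^sup>2))"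
      using par by simp
    finally show ?thesis by (simp add: algebra_simps)
  qed
  then show ?thesis using rho_L_linear_tree_le_iff[OF ne] by blast
qed

section \<open>Eliminating the pendant paths\<close>

text \<open>One elimination step: a concave quadratic in \<open>z\<close> has its maximum at
  \<open>z = y / b\<close>. It serves both for the pendant paths and for the path vertices.\<close>

lemma completed_square_le:
  fixes b y z :: real
  assumes "b < 0"
  shows "b * z\<^sup>2 - 2 * y * z + y\<^sup>2 \<le> (1 - 1 / b) * y\<^sup>2"
proof -
  have "b * z\<^sup>2 - 2 * y * z + y\<^sup>2 - (1 - 1 / b) * y\<^sup>2 = (b * z - y)\<^sup>2 / b"
    using assms by (simp add: field_simps power2_eq_square)
  also have "\<dots> \<le> 0" using assms by (simp add: divide_nonneg_neg)
  finally show ?thesis by simp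
qed

lemma completed_square_eq:
  fixes b y :: real
  assumes "b < 0"
  shows "b * (y / b)\<^sup>2 - 2 * y * (y / b) + y\<^sup>2 = (1 - 1 / b) * y\<^sup>2"
  using assms by (simp add: field_simps power2_eq_square)

text \<open>The value 1 at index 0, outside the range of the paper's recursion, is the one that extends the
  recursion to all indices. It makes the summand \<open>1 - 1 / b\<^sub>0\<close> vanish, so that the tree \<open>[0]\<close> needs no
  separate treatment.\<close>

lemma drift_b_Suc: "drift_b \<mu> (Suc q) = 2 - \<mu> - 1 / drift_b \<mu> q"
  by (cases q) auto

text \<open>From \<open>b \<le> -1\<close> follows \<open>- 1 / b \<le> 1\<close>, so the next value
  is at most \<open>3 - \<mu>\<close>; the bound 4 is just what keeps it at most -1.\<close>

lemma drift_b_Suc_le: "\<mu> \<ge> 4 \<Longrightarrow> drift_b \<mu> (Suc q) \<le> -1"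
proof (induction q)
  case (Suc q)
  then have "drift_b \<mu> (Suc q) \<le> -1" by simp
  then have "- 1 / drift_b \<mu> (Suc q) \<le> 1" by (simp add: divide_simps)
  then show ?case using Suc.prems by (simp add: drift_b_Suc[of _ "Suc q"])
qed auto

lemma drift_alt: "drift q \<mu> = (\<Sum>i<length q. 1 - 1 / drift_b \<mu> (q ! i))"
  by (simp add: drift_def)

text \<open>The value at the path vertex is \<open>z 0\<close>. The edge to it is included, but its
  own term with \<open>\<mu>\<close> is left to the path.\<close>

definition leg_form :: "real \<Rightarrow> nat \<Rightarrow> (nat \<Rightarrow> real) \<Rightarrow> real" where
  "leg_form \<mu> q z = (\<Sum>p<q. (z (Suc p) - z p)\<^sup>2 - \<mu> * (z (Suc p))\<^sup>2)"

lemma leg_form_Suc: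
  "leg_form \<mu> (Suc q) z = (z 1 - z 0)\<^sup>2 - \<mu> * (z 1)\<^sup>2 + leg_form \<mu> q (\<lambda>p. z (Suc p))"
  unfolding leg_form_def sum.lessThan_Suc_shift by simp

text \<open>This is where the recursion for \<open>drift_b\<close> comes from: once the rest of the
  leg is maximised out, \<open>drift_b \<mu> (Suc q)\<close> is the coefficient of
  \<open>z^2\<close>.\<close>

lemma leg_step:
  "(z - y)\<^sup>2 - \<mu> * z\<^sup>2 + (1 - 1 / drift_b \<mu> q) * z\<^sup>2 = drift_b \<mu> (Suc q) * z\<^sup>2 - 2 * y * z + y\<^sup>2"
  unfolding drift_b_Suc by (simp add: algebra_simps power2_eq_square)

text \<open>By induction on the length, \<open>1 - 1 / b\<^sub>q\<close> is the largest contribution of a pendant path with \<open>q\<close>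
  vertices to the form \<open>L - \<mu>\<close> when the value 1 is prescribed at the path vertex.\<close>

lemma leg_form_le:
  assumes "\<mu> \<ge> 4"
  shows "leg_form \<mu> q z \<le> (1 - 1 / drift_b \<mu> q) * (z 0)\<^sup>2"
proof (induction q arbitrary: z)
  case (Suc q)
  have "leg_form \<mu> (Suc q) z \<le> (z 1 - z 0)\<^sup>2 - \<mu> * (z 1)\<^sup>2 + (1 - 1 / drift_b \<mu> q) * (z 1)\<^sup>2"
    unfolding leg_form_Suc using Suc.IH[of "\<lambda>p. z (Suc p)"] by simp
  also have "\<dots> = drift_b \<mu> (Suc q) * (z 1)\<^sup>2 - 2 * z 0 * z 1 + (z 0)\<^sup>2" by (rule leg_step)
  also have "\<dots> \<le> (1 - 1 / drift_b \<mu> (Suc q)) * (z 0)\<^sup>2"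
    using drift_b_Suc_le[OF assms, of q] by (intro completed_square_le) simp
  finally show ?case .
qed (simp add: leg_form_def)

text \<open>Equality in the previous bound: the first leg vertex takes the optimal value
  \<open>y / b\<close>, and the induction hypothesis fills in the rest.\<close>

lemma leg_form_attained:
  assumes "\<mu> \<ge> 4"
  shows "\<exists>z. z 0 = y \<and> leg_form \<mu> q z = (1 - 1 / drift_b \<mu> q) * y\<^sup>2"
proof (induction q arbitrary: y)
  case 0
  show ?case by (intro exI[of _ "\<lambda>_. y"]) (simp add: leg_form_def)
next
  case (Suc q)
  define b where "b = drift_b \<mu> (Suc q)"
  have b: "b < 0" using drift_b_Suc_le[OF assms, of q] by (simp add: b_def)
  obtain z where z: "z 0 = y / b" "leg_form \<mu> q z = (1 - 1 / drift_b \<mu> q) * (y / b)\<^sup>2"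
    using Suc.IH by blast
  have "leg_form \<mu> (Suc q) (case_nat y z)
      = (y / b - y)\<^sup>2 - \<mu> * (y / b)\<^sup>2 + (1 - 1 / drift_b \<mu> q) * (y / b)\<^sup>2"
    unfolding leg_form_Suc using z by simp
  also have "\<dots> = (1 - 1 / b) * y\<^sup>2"
    unfolding leg_step b_def[symmetric] by (rule completed_square_eq[OF b])
  finally show ?case unfolding b_def by (intro exI[of _ "case_nat y z"]) simp
qed

section \<open>The reduced form on the path\<close>

definition chain_form :: "(nat \<Rightarrow> real) \<Rightarrow> nat \<Rightarrow> (nat \<Rightarrow> real) \<Rightarrow> real" where
  "chain_form c n y = (\<Sum>j\<le>n. c j * (y j)\<^sup>2) + (\<Sum>j<n. (y (Suc j) - y j)\<^sup>2)"

lemma chain_form_mono: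
  assumes "\<And>j. j \<le> n \<Longrightarrow> c j \<le> c' j"
  shows "chain_form c n y \<le> chain_form c' n y"
  unfolding chain_form_def using assms by (intro add_right_mono sum_mono mult_right_mono) auto

lemma chain_form_Suc:
  "chain_form c (Suc n) y = chain_form c n y + (y (Suc n) - y n)\<^sup>2 + c (Suc n) * (y (Suc n))\<^sup>2"
  unfolding chain_form_def by simp

lemma nth_Gseq_entries: "j < k \<Longrightarrow> map T [1..<Suc k] ! j = T (Suc j)"
  by (simp add: nth_upt del: upt_Suc)

text \<open>The vertices split into the path \<open>S\<close> and the legs \<open>L\<close>.
  Positions count from 0, so position \<open>j\<close> carries the entry
  \<open>T (Suc j)\<close>.\<close>

lemma Gseq_form:
  fixes T :: "nat \<Rightarrow> nat list" and n :: nat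
  defines "V \<equiv> linear_tree_verts (map T [1..<Suc (Suc n)])"
  shows "tree_form V x - \<mu> * (\<Sum>v\<in>V. (x v)\<^sup>2) =
    chain_form (\<lambda>_. - \<mu>) n (\<lambda>j. x (j, 0, 0)) +
    (\<Sum>j\<le>n. \<Sum>i<length (T (Suc j)). leg_form \<mu> (T (Suc j) ! i)
        (\<lambda>p. if p = 0 then x (j, 0, 0) else x (j, i, p)))"
proof -
  define L where "L = (SIGMA j:{..n}. SIGMA i:{..<length (T (Suc j))}. {1..T (Suc j) ! i})"
  define S where "S = (\<lambda>j. (j, 0::nat, 0::nat)) ` {..n}"
  have len: "length (map T [1..<Suc (Suc n)]) = Suc n" by simp
  have V: "V = S \<union> L"
    unfolding V_def linear_tree_verts_alt len lessThan_Suc_atMost S_def L_def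
    by (auto simp: nth_Gseq_entries simp del: upt_Suc)
  have fin: "finite L" "finite S" unfolding L_def S_def by (auto intro!: finite_SigmaI)
  have disj: "S \<inter> L = {}" unfolding L_def S_def by auto
  have S': "S - {(0, 0, 0)} = (\<lambda>j. (Suc j, 0, 0)) ` {..<n}"
  proof (intro equalityI subsetI)
    fix v assume "v \<in> S - {(0, 0, 0)}"
    then obtain j where "v = (j, 0, 0)" "j \<le> n" "j \<noteq> 0" by (auto simp: S_def)
    then show "v \<in> (\<lambda>j. (Suc j, 0, 0)) ` {..<n}" by (cases j) auto
  qed (auto simp: S_def)
  have sumL: "(\<Sum>v\<in>L. g v) = (\<Sum>j\<le>n. \<Sum>i<length (T (Suc j)). \<Sum>p<T (Suc j) ! i. g (j, i, Suc p))"
    for g :: "nat \<times> nat \<times> nat \<Rightarrow> real"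
    unfolding L_def
    by (subst sum.Sigma[symmetric, where g = "\<lambda>j v. g (j, v)", simplified]; simp?)
       (subst sum.Sigma[symmetric, where g = "\<lambda>i p. g (_, i, p)", simplified];
         simp add: sum.atLeast1_atMost_eq)
  have "V - {(0, 0, 0)} = (S - {(0, 0, 0)}) \<union> L" using V by (auto simp: L_def)
  then have "tree_form V x = (\<Sum>v\<in>S - {(0, 0, 0)}. (x v - x (parent v))\<^sup>2) + (\<Sum>v\<in>L. (x v - x (parent v))\<^sup>2)"
    unfolding tree_form_def using fin disj by (simp add: sum.union_disjoint Int_Diff Diff_Int_distrib2)
  moreover have "(\<Sum>v\<in>S - {(0, 0, 0)}. (x v - x (parent v))\<^sup>2) = (\<Sum>j<n. (x (Suc j, 0, 0) - x (j, 0, 0))\<^sup>2)"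
    unfolding S' by (subst sum.reindex) (auto simp: inj_on_def)
  moreover have "(\<Sum>v\<in>V. (x v)\<^sup>2) = (\<Sum>v\<in>S. (x v)\<^sup>2) + (\<Sum>v\<in>L. (x v)\<^sup>2)"
    unfolding V using fin disj by (rule_tac sum.union_disjoint)
  moreover have "(\<Sum>v\<in>S. (x v)\<^sup>2) = (\<Sum>j\<le>n. (x (j, 0, 0))\<^sup>2)"
    unfolding S_def by (subst sum.reindex) (auto simp: inj_on_def)
  moreover have "(\<Sum>v\<in>L. (x v - x (parent v))\<^sup>2) - \<mu> * (\<Sum>v\<in>L. (x v)\<^sup>2) =
      (\<Sum>j\<le>n. \<Sum>i<length (T (Suc j)). leg_form \<mu> (T (Suc j) ! i)
        (\<lambda>p. if p = 0 then x (j, 0, 0) else x (j, i, p)))"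
  proof -
    \<comment> \<open>The first vertex of a leg has the path vertex as parent; this is why index 0
      of the leg function is redirected to \<open>(j, 0, 0)\<close>.\<close>
    have par: "parent (j, i, Suc p) = (if p = 0 then (j, 0, 0) else (j, i, p))" for j i p
      by (cases p) auto
    show ?thesis
      unfolding sum_distrib_left sum_subtractf[symmetric] sumL leg_form_def par
      by (intro sum.cong refl) auto
  qed
  ultimately show ?thesis
    unfolding chain_form_def by (simp add: algebra_simps sum_negf flip: sum_distrib_left)
qed

text \<open>Forwards, values on the path are extended optimally along all legs; backwards, each leg
  is replaced by its upper bound.\<close>

lemma rho_L_Gseq_le_iff:
  assumes "\<mu> \<ge> 4"
  shows "rho_L (Gseq T (Suc n)) \<le> \<mu> \<longleftrightarrow>
    (\<forall>y. chain_form (\<lambda>j. drift (T (Suc j)) \<mu> - \<mu>) n y \<le> 0)"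
proof -
  let ?V = "linear_tree_verts (map T [1..<Suc (Suc n)])"
  let ?form = "\<lambda>x. tree_form ?V x - \<mu> * (\<Sum>v\<in>?V. (x v)\<^sup>2)"
  let ?legs = "\<lambda>x. \<Sum>j\<le>n. \<Sum>i<length (T (Suc j)). leg_form \<mu> (T (Suc j) ! i)
        (\<lambda>p. if p = 0 then x (j, 0, 0) else x (j, i, p))"
  have "rho_L (Gseq T (Suc n)) \<le> \<mu> \<longleftrightarrow> (\<forall>x. ?form x \<le> 0)"
    unfolding Gseq_def by (subst rho_L_linear_tree_le_iff) auto
  also have "\<dots> \<longleftrightarrow> (\<forall>y. chain_form (\<lambda>j. drift (T (Suc j)) \<mu> - \<mu>) n y \<le> 0)"
  proof (intro iffI allI)
    fix y assume *: "\<forall>x. ?form x \<le> 0"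
    have "\<forall>j i. \<exists>z. z 0 = y j \<and>
        leg_form \<mu> (T (Suc j) ! i) z = (1 - 1 / drift_b \<mu> (T (Suc j) ! i)) * (y j)\<^sup>2"
      using leg_form_attained[OF assms] by blast
    then obtain z where z: "\<And>j i. z j i 0 = y j"
      "\<And>j i. leg_form \<mu> (T (Suc j) ! i) (z j i) = (1 - 1 / drift_b \<mu> (T (Suc j) ! i)) * (y j)\<^sup>2"
      by metis
    define x where "x = (\<lambda>(j, i, p). z j i p)"
    have zx: "(\<lambda>p. if p = 0 then x (j, 0, 0) else x (j, i, p)) = z j i" for j i
      by (auto simp: x_def z(1))
    have "?legs x = (\<Sum>j\<le>n. drift (T (Suc j)) \<mu> * (y j)\<^sup>2)"
      unfolding zx z(2) drift_alt by (simp add: sum_distrib_right)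
    moreover have "x (j, 0, 0) = y j" for j by (simp add: x_def z(1))
    ultimately have "?form x = chain_form (\<lambda>j. drift (T (Suc j)) \<mu> - \<mu>) n y"
      unfolding Gseq_form chain_form_def by (simp add: algebra_simps sum.distrib sum_subtractf sum_negf)
    then show "chain_form (\<lambda>j. drift (T (Suc j)) \<mu> - \<mu>) n y \<le> 0" using * by metis
  next
    fix x assume *: "\<forall>y. chain_form (\<lambda>j. drift (T (Suc j)) \<mu> - \<mu>) n y \<le> 0"
    have "?legs x \<le> (\<Sum>j\<le>n. \<Sum>i<length (T (Suc j)). (1 - 1 / drift_b \<mu> (T (Suc j) ! i)) * (x (j, 0, 0))\<^sup>2)"
    proof (intro sum_mono)
      fix j i
      show "leg_form \<mu> (T (Suc j) ! i) (\<lambda>p. if p = 0 then x (j, 0, 0) else x (j, i, p))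
          \<le> (1 - 1 / drift_b \<mu> (T (Suc j) ! i)) * (x (j, 0, 0))\<^sup>2"
        using leg_form_le[OF assms, of _ "\<lambda>p. if p = 0 then x (j, 0, 0) else x (j, i, p)"] by simp
    qed
    also have "\<dots> = (\<Sum>j\<le>n. drift (T (Suc j)) \<mu> * (x (j, 0, 0))\<^sup>2)"
      by (simp add: drift_alt sum_distrib_right)
    finally have "?form x \<le> chain_form (\<lambda>j. drift (T (Suc j)) \<mu> - \<mu>) n (\<lambda>j. x (j, 0, 0))"
      unfolding Gseq_form chain_form_def by (simp add: algebra_simps sum.distrib sum_subtractf sum_negf)
    also have "\<dots> \<le> 0" using * by blast
    finally show "?form x \<le> 0" .
  qed
  finally show ?thesis .
qed

section \<open>Limits of spectral radii\<close>

lemma linear_tree_verts_Gseq: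
  "linear_tree_verts (map T [1..<Suc k]) = {(j, 0, 0) |j. j < k} \<union>
     {(j, i, p) |j i p. j < k \<and> i < length (T (Suc j)) \<and> 1 \<le> p \<and> p \<le> T (Suc j) ! i}"
  unfolding linear_tree_verts_def by (auto simp: nth_Gseq_entries simp del: upt_Suc)

text \<open>Shortening the sequence and emptying entries both shrink the vertex set, so one
  comparison covers prolongation and truncation.\<close>

lemma rho_L_Gseq_mono:
  assumes "1 \<le> k" "k \<le> k'" "\<And>j. 1 \<le> j \<Longrightarrow> j \<le> k \<Longrightarrow> T j = T' j \<or> T j = [0]"
  shows "rho_L (Gseq T k) \<le> rho_L (Gseq T' k')"
  unfolding Gseq_def
proof (rule rho_L_linear_tree_mono)
  show "map T [1..<Suc k] \<noteq> []" using assms(1) by simp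
  have "T (Suc j) = T' (Suc j) \<or> T (Suc j) = [0]" if "j < k" for j using assms(3)[of "Suc j"] that by simp
  then show "linear_tree_verts (map T [1..<Suc k]) \<subseteq> linear_tree_verts (map T' [1..<Suc k'])"
    unfolding linear_tree_verts_Gseq using assms(2) by fastforce
qed

lemma rho_L_Gseq_bounded:
  assumes "bounded_width T"
  shows "\<exists>C. \<forall>k\<ge>1. rho_L (Gseq T k) \<le> C"
proof -
  obtain w where w: "\<And>j. j \<ge> 1 \<Longrightarrow> tree_width (T j) \<le> w"
    using assms unfolding bounded_width_def by blast
  \<comment> \<open>The tree \<open>[0]\<close> has width 0 but length 1, hence
    \<open>Suc w\<close>.\<close>
  have "length (T j) \<le> Suc w" if "j \<ge> 1" for j
    using w[OF that] by (auto simp: tree_width_def split: if_splits)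
  then have "rho_L (Gseq T k) \<le> 2 * real (Suc w) + 6" if "k \<ge> 1" for k
    unfolding Gseq_def using that by (intro rho_L_linear_tree_bounded) auto
  then show ?thesis by blast
qed

lemma
  assumes "bounded_width T"
  shows rho_limit_LIMSEQ: "(\<lambda>k. rho_L (Gseq T k)) \<longlonglongrightarrow> rho_limit T"
    and rho_L_le_rho_limit: "1 \<le> k \<Longrightarrow> rho_L (Gseq T k) \<le> rho_limit T"
proof -
  \<comment> \<open>Shifted by one because \<open>Gseq T 0\<close> is the empty graph and
    monotonicity starts at 1.\<close>
  define f where "f k = rho_L (Gseq T (Suc k))" for k
  obtain C where C: "\<And>k. f k \<le> C" using rho_L_Gseq_bounded[OF assms] unfolding f_def by auto
  have "incseq f" unfolding f_def by (intro incseq_SucI rho_L_Gseq_mono) auto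
  from incseq_convergent[OF this, of C] C
  obtain L where L: "f \<longlonglongrightarrow> L" "\<And>k. f k \<le> L" by blast
  have lim: "(\<lambda>k. rho_L (Gseq T k)) \<longlonglongrightarrow> L"
    using L(1) unfolding f_def by (rule LIMSEQ_imp_Suc)
  then have "rho_limit T = L" unfolding rho_limit_def by (rule limI)
  with lim show "(\<lambda>k. rho_L (Gseq T k)) \<longlonglongrightarrow> rho_limit T" by simp
  show "1 \<le> k \<Longrightarrow> rho_L (Gseq T k) \<le> rho_limit T"
    using L(2)[of "k - 1"] \<open>rho_limit T = L\<close> by (simp add: f_def)
qed

lemma rho_limit_le_iff:
  assumes "bounded_width T"
  shows "rho_limit T \<le> \<mu> \<longleftrightarrow> (\<forall>k\<ge>1. rho_L (Gseq T k) \<le> \<mu>)"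
proof
  show "\<forall>k\<ge>1. rho_L (Gseq T k) \<le> \<mu>" if "rho_limit T \<le> \<mu>"
    using rho_L_le_rho_limit[OF assms] that by (auto intro: order_trans)
  show "rho_limit T \<le> \<mu>" if "\<forall>k\<ge>1. rho_L (Gseq T k) \<le> \<mu>"
    using LIMSEQ_le_const2[OF rho_limit_LIMSEQ[OF assms], of \<mu>] that by blast
qed

text \<open>Alternating signs on the path and zero on the legs give 4 for each of the
  \<open>n\<close> path edges against \<open>n + 1\<close> vertices; letting \<open>n\<close> grow
  forces the bound. It puts every limit in the range where the legs can be eliminated.\<close>

lemma rho_limit_ge_4:
  assumes "bounded_width T"
  shows "rho_limit T \<ge> 4"
proof -
  define \<mu> where "\<mu> = rho_limit T"
  have le: "(4 - \<mu>) * real n \<le> \<mu>" for n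
  proof -
    let ?V = "linear_tree_verts (map T [1..<Suc (Suc n)])"
    let ?x = "\<lambda>(j, i, p). if i = 0 \<and> p = 0 then (- 1) ^ j else 0 :: real"
    define S where "S = (\<lambda>j. (j, 0::nat, 0::nat)) ` {..n}"
    define S' where "S' = (\<lambda>j. (Suc j, 0::nat, 0::nat)) ` {..<n}"
    have fin: "finite ?V" by (rule finite_linear_tree_verts)
    have "rho_L (Gseq T (Suc n)) \<le> \<mu>" unfolding \<mu>_def by (intro rho_L_le_rho_limit assms) simp
    then have "tree_form ?V ?x \<le> \<mu> * (\<Sum>v\<in>?V. (?x v)\<^sup>2)"
      unfolding Gseq_def by (subst (asm) rho_L_linear_tree_le_iff) auto
    moreover have "(\<Sum>v\<in>?V. (?x v)\<^sup>2) = (\<Sum>v\<in>S. (?x v)\<^sup>2)"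
      using fin unfolding linear_tree_verts_Gseq S_def
      by (intro sum.mono_neutral_right) (auto simp: image_iff)
    moreover have "(\<Sum>v\<in>S. (?x v)\<^sup>2) = real (Suc n)"
      unfolding S_def by (subst sum.reindex) (auto simp: inj_on_def power_mult[symmetric] mult.commute)
    moreover have "(\<Sum>v\<in>S'. (?x v - ?x (parent v))\<^sup>2) = 4 * real n"
      unfolding S'_def by (subst sum.reindex) (auto simp: inj_on_def power_mult_distrib power2_eq_square power_add[symmetric])
    moreover have "(\<Sum>v\<in>S'. (?x v - ?x (parent v))\<^sup>2) \<le> tree_form ?V ?x"
      unfolding tree_form_def
    proof (rule sum_mono2)
      show "finite (?V - {(0, 0, 0)})" using fin by blast
      show "S' \<subseteq> ?V - {(0, 0, 0)}" unfolding linear_tree_verts_Gseq S'_def by auto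
    qed auto
    ultimately show ?thesis by (simp add: algebra_simps)
  qed
  show ?thesis
  proof (rule ccontr)
    assume "\<not> ?thesis"
    then have "4 - \<mu> > 0" by (simp add: \<mu>_def)
    then obtain n where "\<mu> < real n * (4 - \<mu>)" using reals_Archimedean3 by blast
    then show False using le[of n] by (simp add: mult.commute)
  qed
qed

lemma bounded_width_update: "bounded_width T \<Longrightarrow> bounded_width (T(j := S))"
  unfolding bounded_width_def
proof (elim exE)
  fix w assume "\<forall>j\<ge>1. tree_width (T j) \<le> w"
  then show "\<exists>w. \<forall>j'\<ge>1. tree_width ((T(j := S)) j') \<le> w"
    by (intro exI[of _ "max w (tree_width S)"]) (auto simp: le_max_iff_disj)
qed

lemma bounded_width_tail: "\<forall>j>k. T j = [0] \<Longrightarrow> bounded_width T"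
proof -
  assume *: "\<forall>j>k. T j = [0]"
  have "tree_width (T j) \<le> Max ((\<lambda>j. tree_width (T j)) ` {..k})" for j
  proof (cases "j \<le> k")
    case False
    then show ?thesis using * by (simp add: tree_width_def)
  qed auto
  then show ?thesis unfolding bounded_width_def by blast
qed

section \<open>Continuity of the drift and replacement of one entry\<close>

lemma drift_b_nonzero: "\<mu> \<ge> 4 \<Longrightarrow> drift_b \<mu> q \<noteq> 0"
  using drift_b_Suc_le[of \<mu> "q - 1"] by (cases q) auto

lemma isCont_drift_b:
  assumes "\<mu> \<ge> 4"
  shows "isCont (\<lambda>\<mu>. drift_b \<mu> q) \<mu>"
proof (induction q)
  case (Suc q)
  then show ?case
    unfolding drift_b_Suc using drift_b_nonzero[OF assms] by (intro continuous_intros)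
qed simp

lemma isCont_drift: "\<mu> \<ge> 4 \<Longrightarrow> isCont (drift q) \<mu>"
  unfolding drift_alt[abs_def]
  by (intro continuous_intros isCont_drift_b drift_b_nonzero)

lemma rho_limit_update_ge:
  assumes bw: "bounded_width T" and drift: "drift S (rho_limit T) > drift (T j0) (rho_limit T)"
  shows "rho_limit (T(j0 := S)) \<ge> rho_limit T"
proof (rule ccontr)
  let ?T = "T(j0 := S)"
  let ?\<mu>0 = "rho_limit T"
  assume "\<not> ?thesis"
  then have less: "rho_limit ?T < ?\<mu>0" by simp
  have bw': "bounded_width ?T" using bw by (rule bounded_width_update)
  note ge = rho_limit_ge_4[OF bw']
  have "isCont (drift S) ?\<mu>0" "isCont (drift (T j0)) ?\<mu>0"
    using ge less by (auto intro!: isCont_drift)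
  then have "isCont (\<lambda>\<mu>. drift S \<mu> - drift (T j0) \<mu>) ?\<mu>0"
    by (intro continuous_intros)
  then have "((\<lambda>\<mu>. drift S \<mu> - drift (T j0) \<mu>) \<longlongrightarrow> drift S ?\<mu>0 - drift (T j0) ?\<mu>0) (at_left ?\<mu>0)"
    unfolding isCont_def by (rule filterlim_mono) (auto simp: at_le)
  then have "eventually (\<lambda>\<mu>. drift S \<mu> - drift (T j0) \<mu> > 0) (at_left ?\<mu>0)"
    using drift by (intro order_tendstoD(1)[where a = 0]) auto
  moreover have "eventually (\<lambda>\<mu>. \<mu> \<in> {rho_limit ?T<..<?\<mu>0}) (at_left ?\<mu>0)"
    by (rule eventually_at_left_real[OF less])
  ultimately have "eventually (\<lambda>\<mu>. drift S \<mu> - drift (T j0) \<mu> > 0 \<and> \<mu> \<in> {rho_limit ?T<..<?\<mu>0}) (at_left ?\<mu>0)"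
    by (rule eventually_conj)
  then obtain \<mu> where \<mu>: "drift S \<mu> > drift (T j0) \<mu>" "rho_limit ?T < \<mu>" "\<mu> < ?\<mu>0"
    using eventually_happens'[OF trivial_limit_at_left_real] by fastforce
  have "\<mu> \<ge> 4" using ge \<mu>(2) by simp
  note iff = rho_L_Gseq_le_iff[OF this]
  have "rho_L (Gseq T k) \<le> \<mu>" if k: "k \<ge> 1" for k
  proof -
    obtain n where n: "k = Suc n" using k by (cases k) auto
    have "rho_L (Gseq ?T (Suc n)) \<le> \<mu>" using rho_L_le_rho_limit[OF bw', of "Suc n"] \<mu>(2) by simp
    then have le: "chain_form (\<lambda>j. drift (?T (Suc j)) \<mu> - \<mu>) n y \<le> 0" for y unfolding iff by blast
    \<comment> \<open>Only the weight of the entry \<open>j0\<close> can differ, and it is larger in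
      the new sequence, so nonpositivity passes back to the old one.\<close>
    have "chain_form (\<lambda>j. drift (T (Suc j)) \<mu> - \<mu>) n y \<le> 0" for y
      using \<mu>(1) by (intro order_trans[OF chain_form_mono le]) auto
    then show ?thesis unfolding n iff by blast
  qed
  then have "?\<mu>0 \<le> \<mu>" using rho_limit_le_iff[OF bw] by blast
  then show False using \<mu>(3) by simp
qed

text \<open>Eliminating the path vertices from left to right: once the vertices before \<open>j\<close> are maximised out,
  \<open>pivot c j\<close> is the coefficient of \<open>(y j)\<^sup>2\<close>, the edge from \<open>j\<close> to \<open>Suc j\<close> included.\<close>

fun pivot :: "(nat \<Rightarrow> real) \<Rightarrow> nat \<Rightarrow> real" where
  "pivot c 0 = 1 + c 0"
| "pivot c (Suc j) = 2 + c (Suc j) - 1 / pivot c j"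

lemma pivot_step:
  "(pivot c n - 1) * y\<^sup>2 + (z - y)\<^sup>2 + c (Suc n) * z\<^sup>2
    = pivot c n * y\<^sup>2 - 2 * z * y + z\<^sup>2 + c (Suc n) * z\<^sup>2"
  by (simp add: algebra_simps power2_eq_square)

text \<open>The last vertex has no edge to a successor, which \<open>pivot\<close> would count;
  hence the \<open>- 1\<close>.\<close>

lemma chain_form_le_pivot:
  assumes "\<And>j. j < n \<Longrightarrow> pivot c j < 0"
  shows "chain_form c n y \<le> (pivot c n - 1) * (y n)\<^sup>2"
  using assms
proof (induction n)
  case (Suc n)
  have "chain_form c (Suc n) y
      \<le> (pivot c n - 1) * (y n)\<^sup>2 + (y (Suc n) - y n)\<^sup>2 + c (Suc n) * (y (Suc n))\<^sup>2"
    unfolding chain_form_Suc using Suc by simp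
  also have "\<dots> \<le> (1 - 1 / pivot c n) * (y (Suc n))\<^sup>2 + c (Suc n) * (y (Suc n))\<^sup>2"
    unfolding pivot_step using Suc.prems by (intro add_right_mono completed_square_le) simp
  finally show ?case by (simp add: algebra_simps)
qed (simp add: chain_form_def)

lemma chain_form_cong:
  "(\<And>j. j \<le> n \<Longrightarrow> y j = y' j) \<Longrightarrow> chain_form c n y = chain_form c n y'"
  unfolding chain_form_def by simp

lemma chain_form_pivot_attained:
  assumes "\<And>j. j < n \<Longrightarrow> pivot c j < 0"
  shows "\<exists>y. y n = v \<and> chain_form c n y = (pivot c n - 1) * v\<^sup>2"
  using assms
proof (induction n arbitrary: v)
  case 0
  show ?case by (intro exI[of _ "\<lambda>_. v"]) (simp add: chain_form_def)
next
  case (Suc n)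
  then obtain y where y: "y n = v / pivot c n"
    "chain_form c n y = (pivot c n - 1) * (v / pivot c n)\<^sup>2" by (metis less_SucI)
  let ?y = "y(Suc n := v)"
  have "chain_form c n ?y = chain_form c n y" by (rule chain_form_cong) auto
  then have "chain_form c (Suc n) ?y = (pivot c n - 1) * (v / pivot c n)\<^sup>2 + (v - v / pivot c n)\<^sup>2
      + c (Suc n) * v\<^sup>2"
    unfolding chain_form_Suc using y by simp
  also have "\<dots> = (1 - 1 / pivot c n) * v\<^sup>2 + c (Suc n) * v\<^sup>2"
    unfolding pivot_step using Suc.prems by (subst completed_square_eq) auto
  finally have "chain_form c (Suc n) ?y = (1 - 1 / pivot c n) * v\<^sup>2 + c (Suc n) * v\<^sup>2" .
  then show ?case by (intro exI[of _ ?y]) (simp add: algebra_simps del: fun_upd_apply, simp)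
qed

text \<open>Were \<open>pivot c j\<close> nonnegative, the value 1 at \<open>j\<close> with optimal
  predecessors and a small negative value at \<open>Suc j\<close> would make the form positive. The
  term with \<open>g\<close> leaves room for a trailing path at \<open>n\<close>.\<close>

lemma pivot_neg_of_chain_form_nonpos:
  assumes le: "\<And>y. chain_form c n y + g * (y n)\<^sup>2 \<le> 0"
  shows "j < n \<Longrightarrow> pivot c j < 0"
proof (induction j rule: less_induct)
  case (less j)
  then have "\<And>i. i < j \<Longrightarrow> pivot c i < 0" by simp
  then obtain y where y: "y j = 1" "chain_form c j y = pivot c j - 1"
    using chain_form_pivot_attained[of j c 1] by auto

  \<comment> \<open>The value at \<open>Suc j\<close> is \<open>s\<close> and all later values are
    0. The constant depends on whether \<open>Suc j\<close> is the last vertex or has a further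
    edge.\<close>
  obtain C where C: "\<And>s. pivot c j - 2 * s + C * s\<^sup>2 \<le> 0"
  proof -
    define z where "z s i = (if i \<le> j then y i else if i = Suc j then s else 0)" for s i
    have "chain_form c j (z s) = chain_form c j y" for s by (rule chain_form_cong) (simp add: z_def)
    then have 1: "chain_form c (Suc j) (z s) = pivot c j - 2 * s + (1 + c (Suc j)) * s\<^sup>2" for s
      unfolding chain_form_Suc by (simp add: z_def y algebra_simps power2_eq_square)
    have 2: "chain_form c (Suc (Suc j) + m) (z s) = pivot c j - 2 * s + (2 + c (Suc j)) * s\<^sup>2" for s m
      by (induction m) (simp_all add: chain_form_Suc[of _ "Suc _"] 1, simp_all add: z_def algebra_simps)
    show thesis
    proof (cases "n = Suc j")
      case True
      have "pivot c j - 2 * s + (1 + c (Suc j) + g) * s\<^sup>2 \<le> 0" for s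
        using le[of "z s"] unfolding True 1 by (simp add: z_def algebra_simps)
      then show thesis by (rule that)
    next
      case False
      with less.prems obtain m where m: "n = Suc (Suc j) + m"
        by (metis Suc_leI le_Suc_ex le_neq_implies_less)
      have "pivot c j - 2 * s + (2 + c (Suc j)) * s\<^sup>2 \<le> 0" for s
        using le[of "z s"] unfolding m 2 by (simp add: z_def)
      then show thesis by (rule that)
    qed
  qed
  show ?case
  proof (rule ccontr)
    assume "\<not> ?case"
    then have nn: "pivot c j \<ge> 0" by simp
    \<comment> \<open>Small enough that \<open>\<bar>C\<bar> * s^2 \<le> - s\<close>, so the linear
      term \<open>- 2 * s\<close> outweighs the quadratic one.\<close>
    define s where "s = - 1 / (\<bar>C\<bar> + 1)"
    have s: "s < 0" "- s * (\<bar>C\<bar> + 1) = 1" by (auto simp: s_def)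
    have "C * s\<^sup>2 \<ge> - (\<bar>C\<bar> * s\<^sup>2)" by (simp add: abs_if)
    moreover have "\<bar>C\<bar> * s\<^sup>2 \<le> - s"
    proof -
      have "\<bar>C\<bar> * s\<^sup>2 \<le> (\<bar>C\<bar> + 1) * s\<^sup>2" by (simp add: algebra_simps)
      also have "\<dots> = (- s * (\<bar>C\<bar> + 1)) * (- s)" by (simp add: power2_eq_square algebra_simps)
      also have "\<dots> = - s" unfolding s(2) by simp
      finally show ?thesis .
    qed
    ultimately show False using C[of s] nn s(1) by linarith
  qed
qed

section \<open>Sequences ending in an infinite path\<close>

lemma chain_form_tail:
  assumes "\<And>j. j > n \<Longrightarrow> c j = - \<mu>"
  shows "chain_form c (n + m) y = chain_form c n y + leg_form \<mu> m (\<lambda>p. y (n + p))"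
proof (induction m)
  case (Suc m)
  then show ?case
    using assms[of "Suc (n + m)"] by (simp add: chain_form_Suc leg_form_def)
qed (simp add: leg_form_def)

lemma neg_inverse_less: "b < - t \<Longrightarrow> t > 0 \<Longrightarrow> - 1 / b < 1 / (t::real)"
  by (simp add: divide_simps)

text \<open>For this \<open>\<mu>\<close> the point \<open>- t\<close> is fixed by the recursion,
  which is increasing on negative numbers, and the first value \<open>1 - \<mu>\<close> lies below
  it.\<close>

lemma drift_b_less:
  assumes "t > 1"
  shows "drift_b (2 + t + 1 / t) (Suc m) < - t"
proof (induction m)
  case (Suc m)
  then have "- 1 / drift_b (2 + t + 1 / t) (Suc m) < 1 / t"
    using assms by (intro neg_inverse_less) auto
  then show ?case by (simp add: drift_b_Suc[of _ "Suc m"])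
next
  case 0
  have "1 / t > 0" using assms by simp
  then show ?case unfolding drift_b.simps by linarith
qed

text \<open>The distance to the fixed point \<open>- t\<close> is divided by
  \<open>t * \<bar>b m\<bar>\<close> in each step, so it shrinks at least by the factor
  \<open>1 / t\<close>.\<close>

lemma drift_b_tendsto:
  assumes "t > 1"
  shows "(\<lambda>m. drift_b (2 + t + 1 / t) m) \<longlonglongrightarrow> - t"
proof -
  define b where "b m = drift_b (2 + t + 1 / t) (Suc m)" for m
  have less: "b m < - t" for m unfolding b_def by (rule drift_b_less[OF assms])
  have rec: "b (Suc m) = - t - 1 / t - 1 / b m" for m
    unfolding b_def by (simp add: drift_b_Suc[of _ "Suc m"])
  have bound: "\<bar>b m + t\<bar> \<le> (1 / t) ^ m * \<bar>b 0 + t\<bar>" for m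
  proof (induction m)
    case (Suc m)
    have "b (Suc m) + t = - ((b m + t) / (t * b m))"
      unfolding rec using less[of m] assms by (simp add: field_simps)
    then have "\<bar>b (Suc m) + t\<bar> = \<bar>b m + t\<bar> / (t * \<bar>b m\<bar>)"
      using assms by (simp only: abs_minus_cancel abs_divide abs_mult)
    also have "\<dots> \<le> \<bar>b m + t\<bar> / t"
    proof (rule divide_left_mono)
      have "1 \<le> \<bar>b m\<bar>" using less[of m] assms by simp
      then show "t \<le> t * \<bar>b m\<bar>" "0 < (t * \<bar>b m\<bar>) * t"
        using assms by (auto intro!: mult_pos_pos)
    qed simp
    also have "\<dots> \<le> ((1 / t) ^ m * \<bar>b 0 + t\<bar>) / t"
      using Suc assms by (intro divide_right_mono) auto
    finally show ?case by simp
  qed simp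
  have "(\<lambda>m. (1 / t) ^ m * \<bar>b 0 + t\<bar>) \<longlonglongrightarrow> 0 * \<bar>b 0 + t\<bar>"
    using assms by (intro tendsto_intros LIMSEQ_power_zero) auto
  then have "(\<lambda>m. b m + t) \<longlonglongrightarrow> 0"
    using bound by (intro Lim_null_comparison[of "\<lambda>m. b m + t"]) (auto intro: always_eventually)
  then have "(\<lambda>m. b m + t - t) \<longlonglongrightarrow> 0 - t" by (intro tendsto_intros)
  then have "(\<lambda>m. drift_b (2 + t + 1 / t) (Suc m)) \<longlonglongrightarrow> - t" by (simp add: b_def)
  then show ?thesis by (rule LIMSEQ_imp_Suc)
qed

lemma add_inverse_gt_2: "t > 1 \<Longrightarrow> t + 1 / t > (2::real)"
proof -
  assume "t > 1"
  then have "t + 1 / t - 2 = (t - 1)\<^sup>2 / t" by (simp add: field_simps power2_eq_square)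
  also have "\<dots> > 0" using \<open>t > 1\<close> by simp
  finally show ?thesis by simp
qed

text \<open>A trailing path with \<open>m\<close> vertices is a pendant path at vertex \<open>n\<close>. For \<open>\<mu> = 2 + t + 1 / t\<close> its
  contribution \<open>1 - 1 / b\<^sub>m\<close> increases to \<open>1 + 1 / t\<close>.\<close>

lemma rho_limit_tail_le_iff:
  fixes T :: "nat \<Rightarrow> nat list" and t :: real
  assumes tail: "\<And>j. j > Suc n \<Longrightarrow> T j = [0]" and t: "t > 1"
  defines "\<mu> \<equiv> 2 + t + 1 / t"
  defines "c \<equiv> \<lambda>j. drift (T (Suc j)) \<mu> - \<mu>"
  shows "rho_limit T \<le> \<mu> \<longleftrightarrow> (\<forall>y. chain_form c n y + (1 + 1 / t) * (y n)\<^sup>2 \<le> 0)"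
proof -
  have bw: "bounded_width T" using tail by (intro bounded_width_tail[of "Suc n"]) auto
  have \<mu>4: "\<mu> \<ge> 4" using add_inverse_gt_2[OF t] by (simp add: \<mu>_def)
  have c: "c j = - \<mu>" if "j > n" for j using that tail[of "Suc j"] by (simp add: c_def drift_def)
  \<comment> \<open>By monotonicity it suffices to look at the trees that contain all of the first
    \<open>Suc n\<close> entries.\<close>
  have "rho_limit T \<le> \<mu> \<longleftrightarrow> (\<forall>m. rho_L (Gseq T (Suc (n + m))) \<le> \<mu>)"
    unfolding rho_limit_le_iff[OF bw]
  proof (intro iffI allI impI)
    fix k :: nat
    assume *: "\<forall>m. rho_L (Gseq T (Suc (n + m))) \<le> \<mu>" and k: "1 \<le> k"
    have "rho_L (Gseq T k) \<le> rho_L (Gseq T (Suc (n + k)))"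
      using k by (intro rho_L_Gseq_mono) auto
    also have "\<dots> \<le> \<mu>" using * by blast
    finally show "rho_L (Gseq T k) \<le> \<mu>" .
  qed simp
  also have "\<dots> \<longleftrightarrow> (\<forall>m y. chain_form c n y + leg_form \<mu> m (\<lambda>p. y (n + p)) \<le> 0)"
    unfolding rho_L_Gseq_le_iff[OF \<mu>4] c_def[symmetric]
    by (subst chain_form_tail[of n c \<mu>, OF c]) simp_all
  also have "\<dots> \<longleftrightarrow> (\<forall>m y. chain_form c n y + (1 - 1 / drift_b \<mu> m) * (y n)\<^sup>2 \<le> 0)"
  proof (intro iffI allI)
    fix m y assume *: "\<forall>m y. chain_form c n y + leg_form \<mu> m (\<lambda>p. y (n + p)) \<le> 0"
    obtain z where z: "z 0 = y n" "leg_form \<mu> m z = (1 - 1 / drift_b \<mu> m) * (y n)\<^sup>2"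
      using leg_form_attained[OF \<mu>4, of "y n" m] by blast
    \<comment> \<open>An optimal trailing path glued to the given values; both agree at
      \<open>n\<close>.\<close>
    define y' where "y' j = (if j \<le> n then y j else z (j - n))" for j
    have "chain_form c n y' = chain_form c n y" by (rule chain_form_cong) (simp add: y'_def)
    moreover have "(\<lambda>p. y' (n + p)) = z" using z(1) by (auto simp: y'_def)
    ultimately show "chain_form c n y + (1 - 1 / drift_b \<mu> m) * (y n)\<^sup>2 \<le> 0"
      using *[rule_format, of y' m] z(2) by simp
  next
    fix m y assume *: "\<forall>m y. chain_form c n y + (1 - 1 / drift_b \<mu> m) * (y n)\<^sup>2 \<le> 0"
    show "chain_form c n y + leg_form \<mu> m (\<lambda>p. y (n + p)) \<le> 0"
      using leg_form_le[OF \<mu>4, of m "\<lambda>p. y (n + p)"] *[rule_format, of y m] by simp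
  qed
  also have "\<dots> \<longleftrightarrow> (\<forall>y. chain_form c n y + (1 + 1 / t) * (y n)\<^sup>2 \<le> 0)"
  proof (intro iffI allI)
    fix y assume *: "\<forall>m y. chain_form c n y + (1 - 1 / drift_b \<mu> m) * (y n)\<^sup>2 \<le> 0"
    have "(\<lambda>m. chain_form c n y + (1 - 1 / drift_b \<mu> m) * (y n)\<^sup>2)
        \<longlonglongrightarrow> chain_form c n y + (1 - 1 / (- t)) * (y n)\<^sup>2"
      using t unfolding \<mu>_def by (intro tendsto_intros drift_b_tendsto) auto
    then have "chain_form c n y + (1 - 1 / (- t)) * (y n)\<^sup>2 \<le> 0"
      by (rule LIMSEQ_le_const2) (use * in blast)
    then show "chain_form c n y + (1 + 1 / t) * (y n)\<^sup>2 \<le> 0" by simp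
  next
    fix m y assume *: "\<forall>y. chain_form c n y + (1 + 1 / t) * (y n)\<^sup>2 \<le> 0"
    have "1 - 1 / drift_b \<mu> m \<le> 1 + 1 / t"
    proof (cases m)
      case (Suc m')
      then have "- 1 / drift_b \<mu> m < 1 / t"
        using drift_b_less[OF t, of m'] t unfolding \<mu>_def by (intro neg_inverse_less) auto
      then show ?thesis by simp
    qed (use t in auto)
    then have "(1 - 1 / drift_b \<mu> m) * (y n)\<^sup>2 \<le> (1 + 1 / t) * (y n)\<^sup>2"
      by (rule mult_right_mono) simp
    then show "chain_form c n y + (1 - 1 / drift_b \<mu> m) * (y n)\<^sup>2 \<le> 0"
      using *[rule_format, of y] by simp
  qed
  finally show ?thesis .
qed

text \<open>The variable is \<open>t\<close> because the infinite path then contributes a rational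
  expression; in terms of \<open>\<mu>\<close> it would involve a square root.\<close>

definition tail_pivot :: "(nat \<Rightarrow> nat list) \<Rightarrow> nat \<Rightarrow> real \<Rightarrow> real" where
  "tail_pivot T n t = pivot (\<lambda>j. drift (T (Suc j)) (2 + t + 1 / t) - (2 + t + 1 / t)) n"

lemma tail_pivot_0: "tail_pivot T 0 t = 1 + (drift (T 1) (2 + t + 1 / t) - (2 + t + 1 / t))"
  and tail_pivot_Suc: "tail_pivot T (Suc n) t =
    2 + (drift (T (Suc (Suc n))) (2 + t + 1 / t) - (2 + t + 1 / t)) - 1 / tail_pivot T n t"
  by (simp_all add: tail_pivot_def)

lemma isCont_tail_pivot:
  assumes t: "t > 1"
  shows "(\<And>j. j < n \<Longrightarrow> tail_pivot T j t \<noteq> 0) \<Longrightarrow> isCont (tail_pivot T n) t"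
proof -
  have \<mu>: "isCont (\<lambda>t. 2 + t + 1 / t) t" using t by (intro continuous_intros) auto
  have "isCont (drift q) (2 + t + 1 / t)" for q
    using add_inverse_gt_2[OF t] by (intro isCont_drift) simp
  note cont = isCont_o2[OF \<mu> this]
  show "(\<And>j. j < n \<Longrightarrow> tail_pivot T j t \<noteq> 0) \<Longrightarrow> isCont (tail_pivot T n) t"
  proof (induction n)
    case 0
    show ?case unfolding tail_pivot_0[abs_def] by (intro continuous_intros cont \<mu>)
  next
    case (Suc n)
    then have "isCont (tail_pivot T n) t" "tail_pivot T n t \<noteq> 0" by simp_all
    then show ?case unfolding tail_pivot_Suc[abs_def] by (intro continuous_intros cont \<mu>)
  qed
qed

text \<open>With the infinite path included, the last coefficient is
  \<open>tail_pivot T n t + 1 / t\<close>. It cannot be positive at the limit; were it negative, all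
  signs would persist for a slightly smaller parameter, which would give a smaller upper
  bound.\<close>

lemma rho_limit_tail_root:
  assumes tail: "\<And>j. j > Suc n \<Longrightarrow> T j = [0]" and gt: "rho_limit T > 4"
  obtains t where "t > 1" "rho_limit T = 2 + t + 1 / t" "tail_pivot T n t + 1 / t = 0"
proof -
  define s where "s = rho_limit T - 2"
  define r where "r = sqrt (s\<^sup>2 - 4)"
  \<comment> \<open>The larger root of \<open>t^2 - s * t + 1 = 0\<close>, real and above 1 because
    \<open>s > 2\<close>.\<close>
  define t where "t = (s + r) / 2"
  have s: "s > 2" using gt by (simp add: s_def)
  then have s2: "s\<^sup>2 > 4" using power_strict_mono[of 2 s 2] by simp
  have r: "r > 0" "r\<^sup>2 = s\<^sup>2 - 4" using s2 by (simp_all add: r_def)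
  then have t: "t > 1" using s unfolding t_def by simp
  have "t * t - s * t + 1 = 0"
    using r(2) by (simp add: t_def field_simps power2_eq_square)
  then have ts: "t + 1 / t = s" using t by (simp add: field_simps)
  then have lim: "rho_limit T = 2 + t + 1 / t" by (simp add: s_def)
  let ?c = "\<lambda>t j. drift (T (Suc j)) (2 + t + 1 / t) - (2 + t + 1 / t)"
  have le: "chain_form (?c t) n y + (1 + 1 / t) * (y n)\<^sup>2 \<le> 0" for y
    using rho_limit_tail_le_iff[of n T, OF tail t] lim by simp
  have neg: "tail_pivot T j t < 0" if "j < n" for j
    unfolding tail_pivot_def by (rule pivot_neg_of_chain_form_nonpos[OF le that])
  have "tail_pivot T n t + 1 / t \<le> 0"
  proof -
    have "\<exists>y. y n = 1 \<and> chain_form (?c t) n y = (pivot (?c t) n - 1) * 1\<^sup>2"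
      using neg by (intro chain_form_pivot_attained) (simp add: tail_pivot_def)
    then obtain y where "y n = 1" "chain_form (?c t) n y = (pivot (?c t) n - 1) * 1\<^sup>2" by blast
    then show ?thesis using le[of y] by (simp add: tail_pivot_def)
  qed
  moreover have "\<not> tail_pivot T n t + 1 / t < 0"
  proof
    assume less: "tail_pivot T n t + 1 / t < 0"
    \<comment> \<open>Negativity of the earlier pivots keeps the reciprocals in the recursion
      continuous.\<close>
    have cont: "isCont (tail_pivot T j) t" if "j \<le> n" for j
      using t neg that by (intro isCont_tail_pivot) (auto simp: less_le)
    have left: "(f \<longlongrightarrow> f t) (at_left t)" if "isCont f t" for f :: "real \<Rightarrow> real"
      using that unfolding isCont_def by (rule filterlim_mono) (auto simp: at_le)
    have "eventually (\<lambda>t. tail_pivot T j t < 0) (at_left t)" if "j < n" for j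
      using order_tendstoD(2)[OF left[OF cont] neg[OF that]] that by simp
    then have "eventually (\<lambda>t. \<forall>j\<in>{..<n}. tail_pivot T j t < 0) (at_left t)"
      by (subst eventually_ball_finite_distrib) auto
    moreover have "isCont (\<lambda>t. tail_pivot T n t + 1 / t) t"
      using cont[of n] t by (intro continuous_intros) auto
    from order_tendstoD(2)[OF left[OF this] less]
    have "eventually (\<lambda>t. tail_pivot T n t + 1 / t < 0) (at_left t)" .
    moreover have "eventually (\<lambda>u. u \<in> {1<..<t}) (at_left t)"
      by (rule eventually_at_left_real[OF t])
    ultimately have "eventually (\<lambda>u. (\<forall>j\<in>{..<n}. tail_pivot T j u < 0) \<and>
        tail_pivot T n u + 1 / u < 0 \<and> u \<in> {1<..<t}) (at_left t)"
      by (intro eventually_conj)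
    from eventually_happens'[OF trivial_limit_at_left_real this]
    obtain u where "(\<forall>j\<in>{..<n}. tail_pivot T j u < 0) \<and>
        tail_pivot T n u + 1 / u < 0 \<and> u \<in> {1<..<t}" ..
    then have u: "\<And>j. j < n \<Longrightarrow> tail_pivot T j u < 0" "tail_pivot T n u + 1 / u < 0" "1 < u" "u < t"
      by auto
    have "chain_form (?c u) n y + (1 + 1 / u) * (y n)\<^sup>2 \<le> 0" for y
    proof -
      have "chain_form (?c u) n y \<le> (tail_pivot T n u - 1) * (y n)\<^sup>2"
        unfolding tail_pivot_def using u(1) by (intro chain_form_le_pivot) (simp add: tail_pivot_def)
      moreover have "(tail_pivot T n u - 1) * (y n)\<^sup>2 + (1 + 1 / u) * (y n)\<^sup>2
          = (tail_pivot T n u + 1 / u) * (y n)\<^sup>2" by (simp add: algebra_simps)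
      moreover have "\<dots> \<le> 0" using u(2) by (simp add: mult_nonpos_nonneg)
      ultimately show ?thesis by linarith
    qed
    then have "rho_limit T \<le> 2 + u + 1 / u"
      using rho_limit_tail_le_iff[of n T, OF tail u(3)] by simp
    \<comment> \<open>The map from \<open>t\<close> to \<open>t + 1 / t\<close> is strictly
      increasing beyond 1.\<close>
    moreover have "u + 1 / u < t + 1 / t"
    proof -
      have "t + 1 / t - (u + 1 / u) = (t - u) * (1 - 1 / (t * u))"
        using u(3) t by (simp add: field_simps)
      moreover have "t * u > 1" using u(3) t less_1_mult by blast
      ultimately have "t + 1 / t - (u + 1 / u) > 0" using u(4) by simp
      then show ?thesis by simp
    qed
    ultimately show False using lim by simp
  qed
  ultimately show thesis using that[OF t lim] by simp
qed

section \<open>Algebraicity of the limits\<close>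

definition int_coeffs :: "real poly \<Rightarrow> bool" where
  "int_coeffs p \<longleftrightarrow> (\<forall>i. coeff p i \<in> \<int>)"

lemma int_coeffs_diff: "int_coeffs p \<Longrightarrow> int_coeffs q \<Longrightarrow> int_coeffs (p - q)"
  and int_coeffs_mult: "int_coeffs p \<Longrightarrow> int_coeffs q \<Longrightarrow> int_coeffs (p * q)"
  and int_coeffs_0: "int_coeffs 0"
  and int_coeffs_pCons: "c \<in> \<int> \<Longrightarrow> int_coeffs p \<Longrightarrow> int_coeffs (pCons c p)"
  unfolding int_coeffs_def
  by (auto simp: coeff_mult coeff_pCons split: nat.split intro!: Ints_sum Ints_mult)

lemma int_coeffs_smult: "c \<in> \<int> \<Longrightarrow> int_coeffs p \<Longrightarrow> int_coeffs (Polynomial.smult c p)"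
  unfolding int_coeffs_def by auto

lemma int_coeffs_sum: "(\<And>i. i \<in> A \<Longrightarrow> int_coeffs (f i)) \<Longrightarrow> int_coeffs (\<Sum>i\<in>A. f i)"
  unfolding int_coeffs_def by (auto simp: coeff_sum intro!: Ints_sum)

text \<open>Dickson polynomials, shifted by 2. They turn \<open>2 * p t * p (1 / t)\<close> into a polynomial
  in \<open>2 + t + 1 / t\<close>.\<close>

fun dickson :: "nat \<Rightarrow> real poly" where
  "dickson 0 = [:2:]"
| "dickson (Suc 0) = [:-2, 1:]"
| "dickson (Suc (Suc n)) = [:-2, 1:] * dickson (Suc n) - dickson n"

lemma poly_dickson: "t \<noteq> 0 \<Longrightarrow> poly (dickson n) (2 + t + 1 / t) = t ^ n + 1 / t ^ n"
  by (induction n rule: dickson.induct) (simp_all add: field_simps)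

lemma int_coeffs_dickson: "int_coeffs (dickson n)"
  by (induction n rule: dickson.induct)
     (auto simp del: mult_pCons_left intro!: int_coeffs_diff int_coeffs_mult int_coeffs_pCons int_coeffs_0)

text \<open>The product \<open>p x * p (1 / x)\<close> is symmetric under inversion, so twice it is
  an integer polynomial \<open>G\<close> in \<open>2 + x + 1 / x\<close>, which vanishes where
  \<open>p\<close> does.\<close>

lemma algebraic_2_plus_add_inverse:
  fixes t :: real
  assumes "algebraic t" "t \<noteq> 0"
  shows "algebraic (2 + t + 1 / t)"
proof -
  obtain p where p: "\<And>i. coeff p i \<in> \<int>" "p \<noteq> 0" "poly p t = 0"
    using assms(1) by (elim algebraicE) auto
  \<comment> \<open>Subtraction on \<open>nat\<close> truncates, so \<open>(i - j) + (j - i)\<close>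
    is the distance of \<open>i\<close> and \<open>j\<close>.\<close>
  define G where "G = (\<Sum>i\<le>degree p. \<Sum>j\<le>degree p.
      Polynomial.smult (coeff p i * coeff p j) (dickson ((i - j) + (j - i))))"
  have G: "poly G (2 + x + 1 / x) = 2 * poly p x * poly p (1 / x)" if x: "x \<noteq> 0" for x
  proof -
    have D: "poly (dickson ((i - j) + (j - i))) (2 + x + 1 / x)
        = x ^ i * (1 / x) ^ j + x ^ j * (1 / x) ^ i" for i j
    proof (cases "i \<le> j")
      case True
      then have "x ^ j = x ^ (j - i) * x ^ i" by (simp flip: power_add)
      then show ?thesis using True x unfolding poly_dickson[OF x] by (simp add: field_simps)
    next
      case False
      then have "x ^ i = x ^ (i - j) * x ^ j" by (simp flip: power_add)
      then show ?thesis using False x unfolding poly_dickson[OF x] by (simp add: field_simps)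
    qed
    have "poly G (2 + x + 1 / x) =
        (\<Sum>i\<le>degree p. \<Sum>j\<le>degree p. (coeff p i * x ^ i) * (coeff p j * (1 / x) ^ j)) +
        (\<Sum>i\<le>degree p. \<Sum>j\<le>degree p. (coeff p i * (1 / x) ^ i) * (coeff p j * x ^ j))"
      unfolding G_def poly_sum poly_smult D sum.distrib[symmetric]
      by (intro sum.cong refl) (simp only: algebra_simps)
    also have "\<dots> = poly p x * poly p (1 / x) + poly p (1 / x) * poly p x"
      unfolding poly_altdef sum_product ..
    finally show ?thesis by simp
  qed
  \<comment> \<open>\<open>G\<close> is nonzero: some positive \<open>x\<close> is such that neither
    \<open>x\<close> nor \<open>1 / x\<close> is among the finitely many roots of
    \<open>p\<close>.\<close>
  have "finite ({x. poly p x = 0} \<union> inverse ` {x. poly p x = 0})"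
    using p(2) by (intro finite_UnI finite_imageI poly_roots_finite)
  then have "\<not> {0<..} \<subseteq> {x. poly p x = 0} \<union> inverse ` {x. poly p x = 0}"
    using infinite_Ioi[of "0::real"] finite_subset by blast
  then obtain x where x: "x \<in> {0<..}" "x \<notin> {x. poly p x = 0} \<union> inverse ` {x. poly p x = 0}"
    by (auto simp only: subset_eq)
  have "poly p (1 / x) \<noteq> 0"
  proof
    assume "poly p (1 / x) = 0"
    then have "x \<in> inverse ` {x. poly p x = 0}" by (intro image_eqI[of _ _ "1 / x"]) auto
    then show False using x(2) by blast
  qed
  then have "poly G (2 + x + 1 / x) \<noteq> 0" using x G[of x] by auto
  then have "G \<noteq> 0" by auto
  moreover have "int_coeffs G"
    unfolding G_def using p(1)
    by (intro int_coeffs_sum int_coeffs_smult int_coeffs_dickson Ints_mult)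
  moreover have "poly G (2 + t + 1 / t) = 0" using G[OF assms(2)] p(3) by simp
  ultimately show ?thesis unfolding int_coeffs_def by (intro algebraicI[of G]) auto
qed

text \<open>For transcendental \<open>t0\<close> this class is closed under sums, differences and reciprocals, the latter even
  for functions vanishing near infinity because \<open>1 / 0 = 0\<close>. A member that vanishes at \<open>t0\<close> vanishes near infinity.\<close>

definition rational_fun_at :: "real \<Rightarrow> (real \<Rightarrow> real) \<Rightarrow> bool" where
  "rational_fun_at t0 f \<longleftrightarrow> (\<exists>p q. int_coeffs p \<and> int_coeffs q \<and> q \<noteq> 0 \<and>
     f t0 = poly p t0 / poly q t0 \<and> eventually (\<lambda>t. f t = poly p t / poly q t) at_top)"

lemma eventually_poly_nonzero:
  fixes q :: "real poly"
  assumes "q \<noteq> 0"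
  shows "eventually (\<lambda>t. poly q t \<noteq> 0) at_top"
proof -
  have "bdd_above {t. poly q t = 0}" using poly_roots_finite[OF assms] by (rule bdd_above_finite)
  then obtain b where "\<And>t. poly q t = 0 \<Longrightarrow> t \<le> b" unfolding bdd_above_def by auto
  then have "poly q t \<noteq> 0" if "t > b" for t using that by force
  then show ?thesis by (rule eventually_mono[OF eventually_gt_at_top[of b]])
qed

lemma poly_nonzero_of_transcendental:
  assumes "\<not> algebraic t0" "int_coeffs q" "q \<noteq> 0"
  shows "poly q t0 \<noteq> 0"
  using assms algebraicI[of q t0] unfolding int_coeffs_def by blast

context
  fixes t0 :: real
  assumes tr: "\<not> algebraic t0"
begin

lemma rational_fun_at_const: "c \<in> \<int> \<Longrightarrow> rational_fun_at t0 (\<lambda>_. c)"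
  unfolding rational_fun_at_def
  by (intro exI[of _ "[:c:]"] exI[of _ "[:1:]"]) (auto intro!: int_coeffs_pCons int_coeffs_0)

lemma rational_fun_at_ident: "rational_fun_at t0 (\<lambda>t. t)"
  unfolding rational_fun_at_def
  by (intro exI[of _ "[:0, 1:]"] exI[of _ "[:1:]"]) (auto intro!: int_coeffs_pCons int_coeffs_0)

lemma rational_fun_at_diff:
  assumes "rational_fun_at t0 f" "rational_fun_at t0 g"
  shows "rational_fun_at t0 (\<lambda>t. f t - g t)"
proof -
  obtain p q where f: "int_coeffs p" "int_coeffs q" "q \<noteq> 0" "f t0 = poly p t0 / poly q t0"
    "eventually (\<lambda>t. f t = poly p t / poly q t) at_top"
    using assms(1) unfolding rational_fun_at_def by auto
  obtain r s where g: "int_coeffs r" "int_coeffs s" "s \<noteq> 0" "g t0 = poly r t0 / poly s t0"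
    "eventually (\<lambda>t. g t = poly r t / poly s t) at_top"
    using assms(2) unfolding rational_fun_at_def by auto
  have eq: "f t - g t = poly (p * s - r * q) t / poly (q * s) t"
    if "f t = poly p t / poly q t" "g t = poly r t / poly s t" "poly q t \<noteq> 0" "poly s t \<noteq> 0" for t
    unfolding that(1,2) using that(3,4) by (simp add: field_simps)
  have "eventually (\<lambda>t. f t - g t = poly (p * s - r * q) t / poly (q * s) t) at_top"
    using f(5) g(5) eventually_poly_nonzero[OF f(3)] eventually_poly_nonzero[OF g(3)]
    by eventually_elim (rule eq)
  moreover have "f t0 - g t0 = poly (p * s - r * q) t0 / poly (q * s) t0"
    using f g poly_nonzero_of_transcendental[OF tr] by (intro eq) auto
  moreover have "int_coeffs (p * s - r * q)" "int_coeffs (q * s)" "q * s \<noteq> 0"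
    using f g by (auto intro!: int_coeffs_diff int_coeffs_mult)
  ultimately show ?thesis unfolding rational_fun_at_def by blast
qed

lemma rational_fun_at_add:
  assumes "rational_fun_at t0 f" "rational_fun_at t0 g"
  shows "rational_fun_at t0 (\<lambda>t. f t + g t)"
proof -
  have "rational_fun_at t0 (\<lambda>t. f t - (0 - g t))"
    using assms by (intro rational_fun_at_diff rational_fun_at_const) auto
  then show ?thesis by simp
qed

lemma rational_fun_at_inverse:
  assumes "rational_fun_at t0 f"
  shows "rational_fun_at t0 (\<lambda>t. 1 / f t)"
proof -
  obtain p q where f: "int_coeffs p" "int_coeffs q" "q \<noteq> 0" "f t0 = poly p t0 / poly q t0"
    "eventually (\<lambda>t. f t = poly p t / poly q t) at_top"
    using assms unfolding rational_fun_at_def by auto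
  show ?thesis
  proof (cases "p = 0")
    case True
    then show ?thesis using f unfolding rational_fun_at_def
      by (intro exI[of _ 0] exI[of _ 1])
         (auto simp: one_pCons elim!: eventually_mono intro!: int_coeffs_0 int_coeffs_pCons)
  next
    case False
    then show ?thesis using f unfolding rational_fun_at_def
      by (intro exI[of _ q] exI[of _ p]) (auto elim!: eventually_mono)
  qed
qed

lemma rational_fun_at_sum:
  "(\<And>i. i < n \<Longrightarrow> rational_fun_at t0 (f i)) \<Longrightarrow> rational_fun_at t0 (\<lambda>t. \<Sum>i<n. f i t)" for n :: nat
  by (induction n) (auto intro: rational_fun_at_const rational_fun_at_add)

lemmas rational_fun_at_intros = rational_fun_at_diff rational_fun_at_add rational_fun_at_inverse
  rational_fun_at_sum rational_fun_at_ident rational_fun_at_const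

lemma rational_fun_at_drift: "rational_fun_at t0 (\<lambda>t. drift q (2 + t + 1 / t))"
proof -
  have "rational_fun_at t0 (\<lambda>t. drift_b (2 + t + 1 / t) i)" for i
  proof (induction i)
    case (Suc i)
    then show ?case unfolding drift_b_Suc by (intro rational_fun_at_intros) auto
  qed (auto intro: rational_fun_at_const)
  then show ?thesis unfolding drift_alt by (intro rational_fun_at_intros) auto
qed

lemma rational_fun_at_tail_pivot: "rational_fun_at t0 (tail_pivot T n)"
proof (induction n)
  case 0
  show ?case unfolding tail_pivot_0[abs_def]
    by (intro rational_fun_at_intros rational_fun_at_drift) auto
next
  case (Suc n)
  then show ?case unfolding tail_pivot_Suc[abs_def]
    by (intro rational_fun_at_intros rational_fun_at_drift) auto
qed

text \<open>A nonzero integer numerator cannot vanish at the transcendental \<open>t0\<close>, so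
  the numerator is the zero polynomial.\<close>

lemma rational_fun_at_zero:
  assumes "rational_fun_at t0 f" "f t0 = 0"
  shows "eventually (\<lambda>t. f t = 0) at_top"
proof -
  obtain p q where f: "int_coeffs p" "int_coeffs q" "q \<noteq> 0" "f t0 = poly p t0 / poly q t0"
    "eventually (\<lambda>t. f t = poly p t / poly q t) at_top"
    using assms unfolding rational_fun_at_def by auto
  have "p = 0"
  proof (rule ccontr)
    assume "p \<noteq> 0"
    then have "f t0 \<noteq> 0"
      unfolding f(4) using f(1-3) by (simp add: poly_nonzero_of_transcendental[OF tr])
    then show False using assms(2) by contradiction
  qed
  then show ?thesis using f(5) by simp
qed

end

section \<open>Behaviour for large parameters and algebraicity\<close>

lemma drift_le: "\<mu> \<ge> 4 \<Longrightarrow> drift q \<mu> \<le> 2 * real (length q)"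
proof -
  assume \<mu>: "\<mu> \<ge> 4"
  have "1 - 1 / drift_b \<mu> i \<le> 2" for i
  proof (cases i)
    case (Suc i')
    then have "drift_b \<mu> i \<le> -1" using drift_b_Suc_le[OF \<mu>] by simp
    then show ?thesis by (simp add: divide_simps)
  qed simp
  then have "drift q \<mu> \<le> (\<Sum>i<length q. 2)" unfolding drift_alt by (intro sum_mono)
  then show ?thesis by simp
qed

text \<open>The drift stays bounded while \<open>- \<mu>\<close> tends to minus infinity. The bound
  -2 controls the reciprocal in the induction and leaves room for the term
  \<open>1 / t\<close>.\<close>

lemma eventually_tail_pivot_le: "eventually (\<lambda>t. tail_pivot T n t \<le> -2) at_top"
proof (induction n)
  case 0
  show ?case
    using eventually_gt_at_top[of 1] eventually_ge_at_top[of "2 * real (length (T 1)) + 1"]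
  proof eventually_elim
    case (elim t)
    have "drift (T 1) (2 + t + 1 / t) \<le> 2 * real (length (T 1))"
      using add_inverse_gt_2[OF elim(1)] by (intro drift_le) simp
    moreover have "1 / t > 0" using elim by simp
    ultimately show ?case using elim unfolding tail_pivot_0 by linarith
  qed
next
  case (Suc n)
  let ?q = "T (Suc (Suc n))"
  show ?case
    using Suc eventually_gt_at_top[of 1] eventually_ge_at_top[of "2 * real (length ?q) + 3"]
  proof eventually_elim
    case (elim t)
    have "drift ?q (2 + t + 1 / t) \<le> 2 * real (length ?q)"
      using add_inverse_gt_2[OF elim(2)] by (intro drift_le) simp
    moreover have "1 / t > 0" using elim by simp
    moreover have "- (1 / tail_pivot T n t) \<le> 1" using elim(1) by (simp add: divide_simps)
    ultimately show ?case using elim unfolding tail_pivot_Suc by linarith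
  qed
qed

lemma algebraic_rho_limit_tail:
  assumes tail: "\<And>j. j > Suc n \<Longrightarrow> T j = [0]"
  shows "algebraic (rho_limit T)"
proof (cases "rho_limit T > 4")
  case False
  have "bounded_width T" using tail by (intro bounded_width_tail[of "Suc n"]) auto
  from rho_limit_ge_4[OF this] False have "rho_limit T = 4" by simp
  then show ?thesis by simp
next
  case True
  obtain t0 where t0: "t0 > 1" "rho_limit T = 2 + t0 + 1 / t0" "tail_pivot T n t0 + 1 / t0 = 0"
    using rho_limit_tail_root[of n T] tail True by blast
  have "algebraic t0"
  proof (rule ccontr)
    assume tr: "\<not> algebraic t0"
    \<comment> \<open>This function vanishes at \<open>t0\<close>, so it would vanish near infinity,
      where it is in fact below -1.\<close>
    have "rational_fun_at t0 (\<lambda>t. tail_pivot T n t + 1 / t)"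
      by (intro rational_fun_at_add rational_fun_at_inverse rational_fun_at_ident
          rational_fun_at_tail_pivot tr)
    from rational_fun_at_zero[OF tr this t0(3)]
    have "eventually (\<lambda>t. tail_pivot T n t + 1 / t = 0) at_top" .
    then have "eventually (\<lambda>t::real. False) at_top"
      using eventually_tail_pivot_le[of T n] eventually_gt_at_top[of 1]
    proof eventually_elim
      case (elim t)
      then have "1 / t < 1" by simp
      then show ?case using elim by linarith
    qed
    then show False by simp
  qed
  then show ?thesis using t0 algebraic_2_plus_add_inverse by simp
qed

section \<open>Replacement, truncation, algebraicity and density of the limits\<close>

theorem theorem6p2:
  fixes T :: "nat \<Rightarrow> nat list" and \<mu>0 \<epsilon> :: real and k\<epsilon> :: nat
  assumes "starlike_seq T" and "bounded_width T"
    and "\<mu>0 = rho_limit T"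
    and "\<epsilon> > 0" and "k\<epsilon> \<ge> 1" and "rho_L (Gseq T k\<epsilon>) > \<mu>0 - \<epsilon>"
  shows "(\<forall>j0 S. j0 \<ge> 1 \<longrightarrow> starlike_tree S \<longrightarrow> drift S \<mu>0 > drift (T j0) \<mu>0 \<longrightarrow>
            rho_limit (T(j0 := S)) \<ge> \<mu>0) \<and>
         rho_limit (\<lambda>j. if j \<le> k\<epsilon> then T j else [0]) \<in> {\<mu>0 - \<epsilon> <.. \<mu>0} \<and>
         (\<forall>x \<in> limits_A. algebraic x) \<and>
         (limits_A \<subseteq> limits_B \<and> limits_B \<subseteq> closure limits_A)"
proof (intro conjI allI impI ballI)
  \<comment> \<open>Stated for arbitrary sequences, since it yields both the interval in (b) and the
    approximation in (d).\<close>
  have trunc: "rho_limit (\<lambda>j. if j \<le> k then U j else [0]) \<in> {rho_limit U - e <.. rho_limit U}"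
    if U: "bounded_width U" "k \<ge> 1" "rho_L (Gseq U k) > rho_limit U - e"
    for U :: "nat \<Rightarrow> nat list" and k e
  proof -
    let ?U = "\<lambda>j. if j \<le> k then U j else [0]"
    have bw: "bounded_width ?U" by (intro bounded_width_tail[of k]) auto
    have "rho_L (Gseq U k) \<le> rho_L (Gseq ?U k)" using U(2) by (intro rho_L_Gseq_mono) auto
    also have "\<dots> \<le> rho_limit ?U" by (rule rho_L_le_rho_limit[OF bw U(2)])
    finally have "rho_limit ?U > rho_limit U - e" using U(3) by simp
    moreover have "rho_limit ?U \<le> rho_limit U"
      unfolding rho_limit_le_iff[OF bw]
    proof (intro allI impI)
      fix m :: nat assume m: "1 \<le> m"
      have "rho_L (Gseq ?U m) \<le> rho_L (Gseq U m)" using m by (intro rho_L_Gseq_mono) auto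
      also have "\<dots> \<le> rho_limit U" by (rule rho_L_le_rho_limit[OF U(1) m])
      finally show "rho_L (Gseq ?U m) \<le> rho_limit U" .
    qed
    ultimately show ?thesis by simp
  qed
  show "rho_limit (\<lambda>j. if j \<le> k\<epsilon> then T j else [0]) \<in> {\<mu>0 - \<epsilon> <.. \<mu>0}"
    using trunc[OF assms(2) assms(5)] assms(3,6) by simp
  show "\<mu>0 \<le> rho_limit (T(j0 := S))" if "drift (T j0) \<mu>0 < drift S \<mu>0" for j0 S
    using rho_limit_update_ge[OF assms(2)] that unfolding assms(3) by blast
  show "algebraic x" if x: "x \<in> limits_A" for x
  proof -
    obtain U k0 where U: "x = rho_limit U" "k0 \<ge> 1" "\<forall>j>k0. U j = [0]"
      using x unfolding limits_A_def by blast
    \<comment> \<open>The tail lemma counts path positions from 0, hence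
      \<open>k0 - 1\<close>.\<close>
    then show ?thesis using algebraic_rho_limit_tail[of "k0 - 1" U] by simp
  qed
  show "limits_A \<subseteq> limits_B"
    unfolding limits_A_def limits_B_def using bounded_width_tail by blast
  show "limits_B \<subseteq> closure limits_A"
  proof
    fix x assume "x \<in> limits_B"
    then obtain U where U: "x = rho_limit U" "starlike_seq U" "bounded_width U"
      unfolding limits_B_def by blast
    show "x \<in> closure limits_A"
      unfolding closure_approachable
    proof (intro allI impI)
      fix e :: real assume e: "e > 0"
      \<comment> \<open>Truncating \<open>U\<close> at any such \<open>k\<close> gives an element of
        \<open>limits_A\<close> within \<open>e\<close> of \<open>x\<close>.\<close>
      have "eventually (\<lambda>k. rho_L (Gseq U k) > x - e) sequentially"
        using e by (intro order_tendstoD(1)[OF rho_limit_LIMSEQ[OF U(3)]]) (simp add: U(1))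
      moreover have "eventually (\<lambda>k. k \<ge> 1) sequentially" by (rule eventually_ge_at_top)
      ultimately have "eventually (\<lambda>k. rho_L (Gseq U k) > x - e \<and> k \<ge> 1) sequentially"
        by (rule eventually_conj)
      from eventually_happens'[OF sequentially_bot this]
      obtain k where k: "rho_L (Gseq U k) > x - e" "k \<ge> 1" by blast
      let ?U = "\<lambda>j. if j \<le> k then U j else [0]"
      have "starlike_seq ?U" using U(2) by (auto simp: starlike_seq_def starlike_tree_def)
      then have "rho_limit ?U \<in> limits_A" unfolding limits_A_def using k(2) by fastforce
      moreover have "dist (rho_limit ?U) x < e"
        using trunc[OF U(3) k(2), of e] k(1) U(1) by (simp add: dist_real_def)
      ultimately show "\<exists>y\<in>limits_A. dist y x < e" by blast
    qed
  qed
qed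

end
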